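(* Let $\ell>0$ and let $u_0\in H^s(\mathbb{R})$ with $s\geqslant2$. Let $T^*$ be the maximal existence time of the unique solution $u\in\mathcal{C}([0,T^*[,H^s(\mathbb{R}))$ of the regularised Burgers equation $u_t+u\,u_x+\ell^2P_x=0$ with $u(0,\cdot)=u_0$. If there exists $x_0\in\mathbb{R}$ such that $u_0'(x_0)<0$, then $$T^*\ \leqslant\ -\,\frac{2}{\inf_{x\in\mathbb{R}}u_0'(x)}.$$
   Context: Here $P=\mathfrak{G}\ast\tfrac12u_x^2$ (convolution in $x$), with $\mathfrak{G}(x)=(2\ell)^{-1}\exp(-|x|/\ell)$; thus $P-\ell^2P_{xx}=\tfrac12u_x^2$ and $P\geqslant0$. Known local well-posedness (Yin), which defines $u$ and $T^*$: for $u_0\in H^s(\mathbb{R})$ with $s>3/2$ there exist a maximal time $T^*\in(0,+\infty]$ (independent of $s$) and a unique solution $u\in\mathcal{C}([0,T^*[,H^s)$ with $u(0,\cdot)=u_0$ such that $T^*<+\infty$ implies $\lim_{t\uparrow T^*}\|u(t,\cdot)\|_{H^s}=+\infty$. Moreover, if $s\geqslant3$, $T^*<+\infty$ implies $\lim_{t\uparrow T^*}\inf_{x}u_x(t,x)=-\infty$. *)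

theory Defs
  imports "HOL-Analysis.Analysis"
begin

definition square_integrable :: "(real \<Rightarrow> 'a::{real_normed_vector}) \<Rightarrow> bool" where
  "square_integrable f \<longleftrightarrow>
     f \<in> borel_measurable lborel \<and> integrable lborel (\<lambda>x. (norm (f x))\<^sup>2)"

definition truncated_fourier :: "nat \<Rightarrow> (real \<Rightarrow> real) \<Rightarrow> real \<Rightarrow> complex" where
  "truncated_fourier n f \<xi> =
     (LINT x:{- real n..real n}|lborel. complex_of_real (f x) * cis (- (\<xi> * x)))"

(* The (non-unitary) Fourier-Plancherel transform: g is the L^2 limit of the Fourier integrals
   of the truncations of f. It is determined by f up to null sets. *)
definition is_fourier :: "(real \<Rightarrow> real) \<Rightarrow> (real \<Rightarrow> complex) \<Rightarrow> bool" where
  "is_fourier f g \<longleftrightarrow> square_integrable f \<and> square_integrable g \<and>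
     (\<lambda>n. \<integral>\<^sup>+\<xi>. ennreal ((cmod (truncated_fourier n f \<xi> - g \<xi>))\<^sup>2) \<partial>lborel) \<longlonglongrightarrow> 0"

definition fourier :: "(real \<Rightarrow> real) \<Rightarrow> real \<Rightarrow> complex" where
  "fourier f = (SOME g. is_fourier f g)"

(* The real-valued Sobolev space H^s for s > 1/2, where every class has exactly one continuous
   representative; elements are those representatives, so that pointwise values and pointwise
   derivatives make sense. For s > 3/2 all elements are C^1 with bounded derivative. *)
definition sobolev :: "real \<Rightarrow> (real \<Rightarrow> real) set" where
  "sobolev s = {f. continuous_on UNIV f \<and>
     (\<exists>g. is_fourier f g \<and> integrable lborel (\<lambda>\<xi>. (1 + \<xi>\<^sup>2) powr s * (cmod (g \<xi>))\<^sup>2))}"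

definition sobolev_norm :: "real \<Rightarrow> (real \<Rightarrow> real) \<Rightarrow> real" where
  "sobolev_norm s f = sqrt (LINT \<xi>|lborel. (1 + \<xi>\<^sup>2) powr s * (cmod (fourier f \<xi>))\<^sup>2)"

definition kernel :: "real \<Rightarrow> real \<Rightarrow> real" where
  "kernel l x = exp (- \<bar>x\<bar> / l) / (2 * l)"

definition pressure :: "real \<Rightarrow> (real \<Rightarrow> real) \<Rightarrow> real \<Rightarrow> real" where
  "pressure l v x = (LINT y|lborel. kernel l (x - y) * ((deriv v y)\<^sup>2 / 2))"

definition time_interval :: "ereal \<Rightarrow> real set" where
  "time_interval T = {t. 0 \<le> t \<and> ereal t < T}"

definition continuous_into_sobolev :: "real \<Rightarrow> ereal \<Rightarrow> (real \<Rightarrow> real \<Rightarrow> real) \<Rightarrow> bool" where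
  "continuous_into_sobolev s T u \<longleftrightarrow>
     (\<forall>t\<in>time_interval T. u t \<in> sobolev s \<and>
        ((\<lambda>\<tau>. sobolev_norm s (\<lambda>x. u \<tau> x - u t x)) \<longlongrightarrow> 0) (at t within time_interval T))"

(* For s > 3/2 and u in C([0,T[, H^s), the terms u u_x and P_x are continuous in time with values
   in H^(s-1), which embeds in the bounded continuous functions; hence the equation can be read
   pointwise, with a one-sided time derivative at t = 0. *)
definition solution ::
    "real \<Rightarrow> real \<Rightarrow> (real \<Rightarrow> real) \<Rightarrow> ereal \<Rightarrow> (real \<Rightarrow> real \<Rightarrow> real) \<Rightarrow> bool" where
  "solution l s u0 T u \<longleftrightarrow>
     0 < T \<and> continuous_into_sobolev s T u \<and> u 0 = u0 \<and>
     (\<forall>t\<in>time_interval T. \<forall>x. \<exists>ut.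
        ((\<lambda>\<tau>. u \<tau> x) has_real_derivative ut) (at t within time_interval T) \<and>
        ut + u t x * deriv (u t) x + l\<^sup>2 * deriv (pressure l (u t)) x = 0)"

definition maximal_solution ::
    "real \<Rightarrow> real \<Rightarrow> (real \<Rightarrow> real) \<Rightarrow> ereal \<Rightarrow> (real \<Rightarrow> real \<Rightarrow> real) \<Rightarrow> bool" where
  "maximal_solution l s u0 T u \<longleftrightarrow>
     solution l s u0 T u \<and> (\<forall>T' v. solution l s u0 T' v \<longrightarrow> T' \<le> T)"

end

theory Submission
  imports Defs "HOL-Probability.Characteristic_Functions" "HOL-Probability.Sinc_Integral"
begin

text \<open>
  Fix a small \<open>h > 0\<close> and let \<open>m(t)\<close> be the minimum over \<open>x\<close> of the secant slope
  \<open>(u(t,x+h) - u(t,x)) / h\<close>. At a minimiser \<open>z\<close> the two endpoint derivatives \<open>u\<^sub>x(t,z)\<close> and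
  \<open>u\<^sub>x(t,z+h)\<close> coincide, so the equation together with \<open>\<ell>\<^sup>2 P\<^sub>x\<^sub>x = P - u\<^sub>x\<^sup>2/2\<close>, \<open>P \<ge> 0\<close> and the
  equicontinuity of \<open>u\<^sub>x\<close> shows that the slope at \<open>z\<close> has time derivative at most
  \<open>-m\<^sup>2/2\<close> up to a relative error that vanishes with \<open>h\<close>. Comparison with the solution of the
  Riccati equation makes \<open>m\<close> unbounded no later than at time \<open>-2/m(0)\<close>. Working with
  secant slopes at their minimum needs neither the second derivative \<open>u\<^sub>x\<^sub>x\<close>, which need not be
  continuous for \<open>s = 2\<close>, nor characteristics. The required properties of \<open>H\<^sup>s\<close> follow from Fourier
  inversion, proved by Gaussian regularisation.
\<close>

section \<open>Fourier inversion\<close>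

text \<open>The comparison fixes a real time \<open>t1\<close> strictly inside the lifespan. On
  [0, \<open>t1\<close>] the derivative u_x is bounded, because the path is continuous into H^s, so
  a barrier that reaches minus infinity at \<open>t1\<close> gives a contradiction. The length h is
  chosen once for the whole interval, hence the appeals to compactness in time. The errors are
  relative because the minimal slope stays below -1/a: an oscillation of u_x below k/a is then below
  k times the slope. Room for the errors comes from a barrier that solves the Riccati equation with
  coefficient a/t1 in place of 1/2; an initial slope below -2/t1 is what allows a < t1/2. The
  minimum m need not be differentiable in time, so a minimiser found at one time is kept fixed for
  slightly later times. It exists because u(t) decays at infinity: secant slopes tend to 0 there,
  and a negative one beats the tails. H^s is defined through an L^2 limit known only up to null
  sets, so every pointwise statement rests on recovering the continuous representative from its
  transform.\<close>

lemma L2_limit_pairing: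
  fixes h :: "nat \<Rightarrow> real \<Rightarrow> complex" and w :: "real \<Rightarrow> complex"
  assumes h [measurable]: "\<And>n. h n \<in> borel_measurable lborel"
    and w: "square_integrable w"
    and lim: "(\<lambda>n. \<integral>\<^sup>+x. ennreal ((cmod (h n x))\<^sup>2) \<partial>lborel) \<longlonglongrightarrow> 0"
  shows "(\<lambda>n. LINT x|lborel. h n x * w x) \<longlonglongrightarrow> 0"
proof (rule tendstoI)
  fix e :: real assume e: "e > 0"
  have [measurable]: "w \<in> borel_measurable lborel" and wi: "integrable lborel (\<lambda>x. (norm (w x))\<^sup>2)"
    using w by (auto simp: square_integrable_def)
  define I where "I = (LINT x|lborel. (norm (w x))\<^sup>2)"
  have I0: "I \<ge> 0" by (simp add: I_def)
  \<comment> \<open>Weight for the bound |h w| <= k |w|^2 + |h|^2 / k. The first term then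
    integrates to less than e/2, and the second contributes at most e/2 once the integral of |h|^2
    is below k e/2.\<close>
  define k where "k = e / (2 * (I + 1))"
  have k: "k > 0" using e I0 by (simp add: k_def)
  have kI: "k * I < e / 2"
  proof -
    have "k * I < k * (I + 1)" using k by simp
    also have "\<dots> = e / 2" using I0 by (simp add: k_def field_simps)
    finally show ?thesis .
  qed
  have "\<forall>\<^sub>F n in sequentially. (\<integral>\<^sup>+x. ennreal ((cmod (h n x))\<^sup>2) \<partial>lborel) < ennreal (k * (e / 2))"
    using lim k e by (intro order_tendstoD(2)[OF lim]) simp
  then show "\<forall>\<^sub>F n in sequentially. dist (LINT x|lborel. h n x * w x) 0 < e"
  proof eventually_elim
    case (elim n)
    show ?case
    proof (cases "integrable lborel (\<lambda>x. h n x * w x)")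
      \<comment> \<open>A Bochner integral that does not exist has the value 0.\<close>
      case False
      then show ?thesis using e by (simp add: not_integrable_integral_eq)
    next
      case True
      have pw: "norm (h n x * w x) \<le> k * (norm (w x))\<^sup>2 + (1/k) * (cmod (h n x))\<^sup>2" for x
      proof -
        let ?a = "cmod (h n x)" and ?b = "norm (w x)"
        have "0 \<le> (?a - k * ?b)\<^sup>2" by simp
        then have "2 * k * (?a * ?b) \<le> k\<^sup>2 * ?b\<^sup>2 + ?a\<^sup>2"
          by (simp add: power2_eq_square algebra_simps)
        then have "2 * (?a * ?b) \<le> k * ?b\<^sup>2 + (1/k) * ?a\<^sup>2"
          using k by (simp add: field_simps power2_eq_square)
        moreover have "0 \<le> ?a * ?b" by simp
        ultimately show ?thesis unfolding norm_mult by linarith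
      qed
      have "ennreal (norm (LINT x|lborel. h n x * w x)) \<le> (\<integral>\<^sup>+x. norm (h n x * w x) \<partial>lborel)"
        by (rule integral_norm_bound_ennreal[OF True])
      also have "\<dots> \<le> (\<integral>\<^sup>+x. ennreal k * ennreal ((norm (w x))\<^sup>2) + ennreal (1/k) * ennreal ((cmod (h n x))\<^sup>2) \<partial>lborel)"
        using pw k by (intro nn_integral_mono) (simp flip: ennreal_mult ennreal_plus)
      also have "\<dots> = ennreal k * (\<integral>\<^sup>+x. ennreal ((norm (w x))\<^sup>2) \<partial>lborel)
          + ennreal (1/k) * (\<integral>\<^sup>+x. ennreal ((cmod (h n x))\<^sup>2) \<partial>lborel)"
        by (subst nn_integral_add) (auto simp: nn_integral_cmult)
      also have "(\<integral>\<^sup>+x. ennreal ((norm (w x))\<^sup>2) \<partial>lborel) = ennreal I"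
        unfolding I_def by (rule nn_integral_eq_integral[OF wi]) simp
      also have "ennreal k * ennreal I + ennreal (1/k) * (\<integral>\<^sup>+x. ennreal ((cmod (h n x))\<^sup>2) \<partial>lborel)
          \<le> ennreal k * ennreal I + ennreal (1/k) * ennreal (k * (e/2))"
        using elim by (intro add_left_mono mult_left_mono) auto
      also have "\<dots> = ennreal (k * I + e / 2)"
        using k e I0 by (simp flip: ennreal_mult ennreal_plus)
      finally have "norm (LINT x|lborel. h n x * w x) \<le> k * I + e / 2"
        using k e I0 by (subst (asm) ennreal_le_iff) auto
      then show ?thesis using kI by simp
    qed
  qed
qed

lemma borel_measurable_cis [measurable]: "cis \<in> borel_measurable borel"
  by (intro borel_measurable_continuous_onI continuous_intros)

lemma truncated_fourier_measurable [measurable]: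
  assumes [measurable]: "f \<in> borel_measurable lborel"
  shows "truncated_fourier n f \<in> borel_measurable lborel"
  unfolding truncated_fourier_def[abs_def] set_lebesgue_integral_def
  by measurable

lemma cmod_diff_square_le:
  fixes a b :: complex
  shows "(cmod (a - b))\<^sup>2 \<le> 2 * (cmod a)\<^sup>2 + 2 * (cmod b)\<^sup>2"
proof -
  have "(cmod (a - b))\<^sup>2 \<le> (cmod a + cmod b)\<^sup>2"
    by (intro power_mono norm_triangle_ineq4) auto
  also have "\<dots> \<le> 2 * (cmod a)\<^sup>2 + 2 * (cmod b)\<^sup>2"
    using zero_le_power2[of "cmod a - cmod b"] by (simp add: power2_eq_square algebra_simps)
  finally show ?thesis .
qed

text \<open>Two L^2 limits of the same truncated transforms F_n are at distance 0, by |g - h|^2 <= 2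
  |F_n - g|^2 + 2 |F_n - h|^2.\<close>

lemma is_fourier_AE_unique:
  assumes g: "is_fourier f g" and h: "is_fourier f h"
  shows "AE x in lborel. g x = h x"
proof -
  have [measurable]: "f \<in> borel_measurable lborel" "g \<in> borel_measurable lborel" "h \<in> borel_measurable lborel"
    using g h by (auto simp: is_fourier_def square_integrable_def)
  let ?G = "\<lambda>n. \<integral>\<^sup>+\<xi>. ennreal ((cmod (truncated_fourier n f \<xi> - g \<xi>))\<^sup>2) \<partial>lborel"
  let ?H = "\<lambda>n. \<integral>\<^sup>+\<xi>. ennreal ((cmod (truncated_fourier n f \<xi> - h \<xi>))\<^sup>2) \<partial>lborel"
  let ?D = "\<integral>\<^sup>+\<xi>. ennreal ((cmod (g \<xi> - h \<xi>))\<^sup>2) \<partial>lborel"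
  have le: "?D \<le> 2 * ?G n + 2 * ?H n" for n
  proof -
    have "?D \<le> (\<integral>\<^sup>+\<xi>. 2 * ennreal ((cmod (truncated_fourier n f \<xi> - g \<xi>))\<^sup>2)
          + 2 * ennreal ((cmod (truncated_fourier n f \<xi> - h \<xi>))\<^sup>2) \<partial>lborel)"
    proof (rule nn_integral_mono)
      fix \<xi>
      let ?a = "truncated_fourier n f \<xi> - g \<xi>" and ?b = "truncated_fourier n f \<xi> - h \<xi>"
      have "(cmod (g \<xi> - h \<xi>))\<^sup>2 \<le> 2 * (cmod ?a)\<^sup>2 + 2 * (cmod ?b)\<^sup>2"
        using cmod_diff_square_le[of ?b ?a] by simp
      then have "ennreal ((cmod (g \<xi> - h \<xi>))\<^sup>2) \<le> ennreal (2 * (cmod ?a)\<^sup>2 + 2 * (cmod ?b)\<^sup>2)"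
        by (rule ennreal_leI)
      then show "ennreal ((cmod (g \<xi> - h \<xi>))\<^sup>2) \<le> 2 * ennreal ((cmod ?a)\<^sup>2) + 2 * ennreal ((cmod ?b)\<^sup>2)"
        by (simp add: ennreal_mult'')
    qed
    also have "\<dots> = 2 * ?G n + 2 * ?H n"
      by (subst nn_integral_add) (auto simp: nn_integral_cmult)
    finally show ?thesis .
  qed
  have "(\<lambda>n. 2 * ?G n + 2 * ?H n) \<longlonglongrightarrow> 2 * 0 + 2 * 0"
    using g h by (intro tendsto_add ennreal_tendsto_cmult) (auto simp: is_fourier_def)
  then have "?D \<le> 2 * 0 + 2 * 0"
    by (rule LIMSEQ_le_const) (use le in blast)
  then have "?D = 0" by simp
  then have "AE x in lborel. ennreal ((cmod (g x - h x))\<^sup>2) = 0"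
    by (subst (asm) nn_integral_0_iff_AE) auto
  then show ?thesis by eventually_elim auto
qed

section \<open>Gaussian weights and regularised inversion\<close>

lemma integrable_gaussian_weight:
  assumes "k > 0"
  shows "integrable lborel (\<lambda>\<xi>::real. exp (- (\<xi> / k)\<^sup>2 / 2))"
proof -
  have "(\<lambda>\<xi>::real. exp (- (\<xi> / k)\<^sup>2 / 2)) = (\<lambda>\<xi>. sqrt (2 * pi * k\<^sup>2) * normal_density 0 k \<xi>)"
    using assms by (auto simp: normal_density_def fun_eq_iff power_divide)
  then show ?thesis using integrable_normal_density[OF assms] by simp
qed

text \<open>Rescaling by \<open>k\<close> turns the integral into the characteristic function of the
  standard normal law. The value is written with a density of standard deviation 1/k, so that
  regularised inversion becomes convolution with a probability density that concentrates as
  \<open>k\<close> grows.\<close>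

lemma fourier_gaussian_weight:
  assumes k: "k > 0"
  shows "(LINT \<xi>|lborel. cis (z * \<xi>) * complex_of_real (exp (- (\<xi> / k)\<^sup>2 / 2)))
    = complex_of_real (2 * pi * normal_density 0 (1 / k) z)"
proof -
  let ?t = "z * k"
  have "(CLINT x|density lborel std_normal_density. iexp (?t * x)) = complex_of_real (exp (- ?t\<^sup>2 / 2))"
    using fun_cong[OF char_std_normal_distribution, of ?t] by (simp add: char_def)
  then have char: "(LINT x|lborel. std_normal_density x *\<^sub>R iexp (?t * x)) = complex_of_real (exp (- ?t\<^sup>2 / 2))"
    by (subst (asm) integral_density) auto
  have "(LINT \<xi>|lborel. cis (z * \<xi>) * complex_of_real (exp (- (\<xi> / k)\<^sup>2 / 2)))
    = k *\<^sub>R (LINT x|lborel. cis (z * (k * x)) * complex_of_real (exp (- x\<^sup>2 / 2)))"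
    using k by (subst lborel_integral_real_affine[where c = k and t = 0]) auto
  also have "(LINT x|lborel. cis (z * (k * x)) * complex_of_real (exp (- x\<^sup>2 / 2)))
    = (LINT x|lborel. complex_of_real (sqrt (2 * pi)) * (std_normal_density x *\<^sub>R iexp (?t * x)))"
    by (intro Bochner_Integration.integral_cong refl)
      (simp add: std_normal_density_def cis_conv_exp scaleR_conv_of_real mult_ac)
  also have "\<dots> = complex_of_real (sqrt (2 * pi)) * complex_of_real (exp (- ?t\<^sup>2 / 2))"
    unfolding char[symmetric] by (rule integral_mult_right_zero)
  also have "k *\<^sub>R (complex_of_real (sqrt (2 * pi)) * complex_of_real (exp (- ?t\<^sup>2 / 2)))
    = complex_of_real (k * (sqrt (2 * pi) * exp (- ?t\<^sup>2 / 2)))"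
    by (simp add: scaleR_conv_of_real)
  also have "k * (sqrt (2 * pi) * exp (- ?t\<^sup>2 / 2)) = 2 * pi * normal_density 0 (1 / k) z"
  proof -
    have "2 * pi = sqrt (2 * pi) * sqrt (2 * pi)" by simp
    then have "2 * pi / sqrt (2 * pi) = sqrt (2 * pi)"
      by (metis nonzero_mult_div_cancel_right pi_gt_zero real_sqrt_eq_zero_cancel_iff zero_less_mult_iff zero_less_numeral less_irrefl)
    then show ?thesis
      using k by (simp add: normal_density_def real_sqrt_divide real_sqrt_mult power_divide field_simps)
  qed
  finally show ?thesis .
qed

text \<open>Fubini exchanges the two integrals, and the inner one becomes a Gaussian transform.
  Truncation supplies absolute integrability: a continuous function is integrable on a compact
  interval, while a square integrable one need not be integrable on the line.\<close>

lemma truncated_fourier_gaussian_pairing: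
  assumes f: "continuous_on UNIV f" and k: "k > 0"
  shows "(LINT \<xi>|lborel. truncated_fourier n f \<xi> * (cis (x * \<xi>) * complex_of_real (exp (- (\<xi> / k)\<^sup>2 / 2))))
    = (LINT y|lborel. complex_of_real (2 * pi * (indicator {- real n..real n} y * f y * normal_density 0 (1 / k) (x - y))))"
proof -
  define w where "w \<xi> = cis (x * \<xi>) * complex_of_real (exp (- (\<xi> / k)\<^sup>2 / 2))" for \<xi>
  define c where "c y = indicator {- real n..real n} y * f y" for y
  have [measurable]: "f \<in> borel_measurable borel"
    using f by (rule borel_measurable_continuous_onI)
  have [measurable]: "w \<in> borel_measurable borel" "c \<in> borel_measurable borel"
    unfolding w_def[abs_def] c_def[abs_def] by measurable
  have c: "integrable lborel c"
    using borel_integrable_compact[of "{- real n..real n}" f] f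
    unfolding c_def[abs_def] by (auto intro: continuous_on_subset)
  have w: "integrable lborel (\<lambda>\<xi>. norm (w \<xi>))"
    using integrable_gaussian_weight[OF k] by (simp add: w_def norm_mult)
  define F where "F \<xi> y = complex_of_real (c y) * cis (- (\<xi> * y)) * w \<xi>" for \<xi> y
  have [measurable]: "case_prod F \<in> borel_measurable (lborel \<Otimes>\<^sub>M lborel)"
    unfolding F_def[abs_def] by measurable
  have int: "integrable (lborel \<Otimes>\<^sub>M lborel) (case_prod F)"
  proof (rule lborel_pair.Fubini_integrable)
    show "integrable lborel (\<lambda>\<xi>. LINT y|lborel. norm (case_prod F (\<xi>, y)))"
      using w by (simp add: F_def norm_mult)
    have "integrable lborel (\<lambda>y. F \<xi> y)" for \<xi>
    proof (rule Bochner_Integration.integrable_bound)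
      show "integrable lborel (\<lambda>y. norm (w \<xi>) * c y)" using c by simp
    qed (simp_all add: F_def norm_mult abs_mult)
    then show "AE \<xi> in lborel. integrable lborel (\<lambda>y. case_prod F (\<xi>, y))" by simp
  qed measurable
  have "(LINT \<xi>|lborel. truncated_fourier n f \<xi> * w \<xi>) = (LINT \<xi>|lborel. LINT y|lborel. F \<xi> y)"
  proof (intro Bochner_Integration.integral_cong refl)
    fix \<xi>
    have "(LINT y|lborel. F \<xi> y) = (LINT y|lborel. complex_of_real (c y) * cis (- (\<xi> * y))) * w \<xi>"
      unfolding F_def by simp
    also have "(LINT y|lborel. complex_of_real (c y) * cis (- (\<xi> * y))) = truncated_fourier n f \<xi>"
      unfolding truncated_fourier_def set_lebesgue_integral_def
      by (intro Bochner_Integration.integral_cong refl) (simp add: c_def indicator_def)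
    finally show "truncated_fourier n f \<xi> * w \<xi> = (LINT y|lborel. F \<xi> y)" ..
  qed
  also have "\<dots> = (LINT y|lborel. LINT \<xi>|lborel. F \<xi> y)"
    by (rule lborel_pair.Fubini_integral[OF int, symmetric])
  also have "\<dots> = (LINT y|lborel. complex_of_real (2 * pi * (c y * normal_density 0 (1 / k) (x - y))))"
  proof (intro Bochner_Integration.integral_cong refl)
    fix y
    have "(LINT \<xi>|lborel. F \<xi> y)
      = (LINT \<xi>|lborel. complex_of_real (c y) * (cis ((x - y) * \<xi>) * complex_of_real (exp (- (\<xi> / k)\<^sup>2 / 2))))"
    proof (intro Bochner_Integration.integral_cong refl)
      fix \<xi>
      have "cis (- (\<xi> * y)) * cis (x * \<xi>) = cis ((x - y) * \<xi>)"
        by (simp add: cis_mult algebra_simps)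
      then show "F \<xi> y = complex_of_real (c y) * (cis ((x - y) * \<xi>) * complex_of_real (exp (- (\<xi> / k)\<^sup>2 / 2)))"
        unfolding F_def w_def by (simp add: mult.assoc[symmetric])
    qed
    also have "\<dots> = complex_of_real (c y) * complex_of_real (2 * pi * normal_density 0 (1 / k) (x - y))"
      using fourier_gaussian_weight[OF k, of "x - y"] by simp
    finally show "(LINT \<xi>|lborel. F \<xi> y) = complex_of_real (2 * pi * (c y * normal_density 0 (1 / k) (x - y)))"
      by simp
  qed
  finally show ?thesis unfolding w_def c_def by simp
qed

text \<open>Gives majorants for functions known only to be square integrable: if 0 <= N <= C and N
  is integrable, then |f| N <= N + C f^2.\<close>

lemma norm_le_one_plus_square: "norm a \<le> 1 + (norm a)\<^sup>2"
proof -
  have "2 * norm a \<le> 1 + (norm a)\<^sup>2"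
    using zero_le_power2[of "norm a - 1"] by (simp add: power2_eq_square algebra_simps)
  then show ?thesis using norm_ge_zero[of a] by linarith
qed

text \<open>The truncation is removed on both sides: on the frequency side by L^2 convergence tested
  against the square integrable Gaussian weight, on the space side by dominated convergence.\<close>

lemma fourier_gaussian_regularisation:
  assumes fg: "is_fourier f g" and f: "continuous_on UNIV f" and k: "k > 0"
  shows "(LINT \<xi>|lborel. g \<xi> * (cis (x * \<xi>) * complex_of_real (exp (- (\<xi> / k)\<^sup>2 / 2))))
    = complex_of_real (2 * pi * (LINT y|lborel. f y * normal_density 0 (1 / k) (x - y)))"
proof -
  define w where "w \<xi> = cis (x * \<xi>) * complex_of_real (exp (- (\<xi> / k)\<^sup>2 / 2))" for \<xi>
  define N where "N y = normal_density 0 (1 / k) (x - y)" for y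
  have [measurable]: "f \<in> borel_measurable borel" "g \<in> borel_measurable borel"
    and f2: "integrable lborel (\<lambda>y. (f y)\<^sup>2)" and g2: "integrable lborel (\<lambda>y. (norm (g y))\<^sup>2)"
    using fg by (auto simp: is_fourier_def square_integrable_def)
  have [measurable]: "w \<in> borel_measurable borel" "N \<in> borel_measurable borel"
    unfolding w_def[abs_def] N_def[abs_def] by measurable
  have nw: "norm (w \<xi>) = exp (- (\<xi> / k)\<^sup>2 / 2)" for \<xi> by (simp add: w_def norm_mult)
  have w1: "norm (w \<xi>) \<le> 1" for \<xi> by (simp add: nw)
  have wi: "integrable lborel (\<lambda>\<xi>. norm (w \<xi>))"
    using integrable_gaussian_weight[OF k] by (simp add: nw)
  have w2: "square_integrable w"
    unfolding square_integrable_def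
  proof
    show "integrable lborel (\<lambda>x. (norm (w x))\<^sup>2)"
    proof (rule Bochner_Integration.integrable_bound[OF wi])
      show "AE x in lborel. norm ((norm (w x))\<^sup>2) \<le> norm (norm (w x))"
        using w1 by (intro always_eventually) (auto simp: power2_eq_square intro: mult_left_le)
    qed measurable
  qed measurable
  have prod: "integrable lborel (\<lambda>\<xi>. h \<xi> * w \<xi>)"
    if [measurable]: "h \<in> borel_measurable borel" and h: "integrable lborel (\<lambda>y. (norm (h y))\<^sup>2)" for h
  proof (rule Bochner_Integration.integrable_bound)
    show "integrable lborel (\<lambda>\<xi>. norm (w \<xi>) + (norm (h \<xi>))\<^sup>2)" using wi h by simp
    show "AE x in lborel. norm (h x * w x) \<le> norm (norm (w x) + (norm (h x))\<^sup>2)"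
    proof (intro always_eventually allI)
      fix \<xi>
      have "norm (h \<xi>) * norm (w \<xi>) \<le> (1 + (norm (h \<xi>))\<^sup>2) * norm (w \<xi>)"
        by (intro mult_right_mono norm_le_one_plus_square) auto
      also have "\<dots> \<le> norm (w \<xi>) + (norm (h \<xi>))\<^sup>2"
        using mult_right_le_one_le[of "(norm (h \<xi>))\<^sup>2" "norm (w \<xi>)"] w1[of \<xi>]
        unfolding distrib_right mult_1_left by simp
      finally show "norm (h \<xi> * w \<xi>) \<le> norm (norm (w \<xi>) + (norm (h \<xi>))\<^sup>2)"
        by (simp add: norm_mult)
    qed
  qed measurable
  have gw: "integrable lborel (\<lambda>\<xi>. g \<xi> * w \<xi>)" using g2 by (intro prod) measurable
  \<comment> \<open>The truncated transform is bounded by the L^1 norm of the truncated function, so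
    its product with the weight is integrable and the integral of the difference can be
    split.\<close>
  have Tb: "integrable lborel (\<lambda>\<xi>. truncated_fourier n f \<xi> * w \<xi>)" for n
  proof (rule Bochner_Integration.integrable_bound)
    let ?C = "LINT y|lborel. norm (indicator {- real n..real n} y * f y)"
    show "integrable lborel (\<lambda>\<xi>. ?C * norm (w \<xi>))" using wi by simp
    show "AE \<xi> in lborel. norm (truncated_fourier n f \<xi> * w \<xi>) \<le> norm (?C * norm (w \<xi>))"
    proof (intro always_eventually allI)
      fix \<xi>
      have "norm (truncated_fourier n f \<xi>) \<le> (LINT y|lborel. norm (indicator {- real n..real n} y *\<^sub>R (complex_of_real (f y) * cis (- (\<xi> * y)))))"
        unfolding truncated_fourier_def set_lebesgue_integral_def by (rule integral_norm_bound)
      also have "\<dots> = ?C" by (simp add: norm_mult abs_mult)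
      finally show "norm (truncated_fourier n f \<xi> * w \<xi>) \<le> norm (?C * norm (w \<xi>))"
        by (auto simp: norm_mult intro!: mult_right_mono)
    qed
  qed measurable
  have "(\<lambda>n. LINT \<xi>|lborel. (truncated_fourier n f \<xi> - g \<xi>) * w \<xi>) \<longlonglongrightarrow> 0"
    using fg by (intro L2_limit_pairing w2) (auto simp: is_fourier_def)
  then have "(\<lambda>n. (LINT \<xi>|lborel. truncated_fourier n f \<xi> * w \<xi>) - (LINT \<xi>|lborel. g \<xi> * w \<xi>)) \<longlonglongrightarrow> 0"
    using Tb gw by (simp add: left_diff_distrib Bochner_Integration.integral_diff)
  then have lim1: "(\<lambda>n. LINT \<xi>|lborel. truncated_fourier n f \<xi> * w \<xi>) \<longlonglongrightarrow> (LINT \<xi>|lborel. g \<xi> * w \<xi>)"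
    by (rule Lim_null[THEN iffD2])
  have N0: "0 \<le> N y" for y by (simp add: N_def)
  define C where "C = 1 / sqrt (2 * pi * (1 / k)\<^sup>2)"
  have NC: "N y \<le> C" and C0: "C \<ge> 0" for y
    by (auto simp: N_def normal_density_def C_def intro!: divide_right_mono)
  have Ni: "integrable lborel N"
    using lborel_integrable_real_affine[of "normal_density 0 (1 / k)" "-1" x] k by (simp add: N_def[abs_def])
  have dom: "integrable lborel (\<lambda>y. N y + C * (f y)\<^sup>2)" using Ni f2 by simp
  have fN: "\<bar>f y * N y\<bar> \<le> N y + C * (f y)\<^sup>2" for y
  proof -
    have "\<bar>f y\<bar> * N y \<le> (1 + (f y)\<^sup>2) * N y"
      using norm_le_one_plus_square[of "f y"] N0 by (intro mult_right_mono) auto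
    also have "\<dots> \<le> N y + C * (f y)\<^sup>2"
      using mult_right_mono[OF NC[of y], of "(f y)\<^sup>2"] by (simp add: algebra_simps)
    finally show ?thesis using N0 by (simp add: abs_mult)
  qed
  have lim2: "(\<lambda>n. LINT y|lborel. indicator {- real n..real n} y * f y * N y) \<longlonglongrightarrow> (LINT y|lborel. f y * N y)"
  proof (rule integral_dominated_convergence[OF _ _ dom])
    show "AE y in lborel. (\<lambda>n. indicator {- real n..real n} y * f y * N y) \<longlonglongrightarrow> f y * N y"
    proof (intro always_eventually allI)
      fix y
      have "\<forall>\<^sub>F n in sequentially. indicator {- real n..real n} y * f y * N y = f y * N y"
        using eventually_ge_at_top[of "nat \<lceil>\<bar>y\<bar>\<rceil>"]
        by eventually_elim (auto simp: indicator_def nat_le_iff ceiling_le_iff)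
      then show "(\<lambda>n. indicator {- real n..real n} y * f y * N y) \<longlonglongrightarrow> f y * N y"
        by (rule tendsto_eventually)
    qed
    show "AE y in lborel. norm (indicator {- real n..real n} y * f y * N y) \<le> N y + C * (f y)\<^sup>2" for n
    proof (intro always_eventually allI)
      fix y
      show "norm (indicator {- real n..real n} y * f y * N y) \<le> N y + C * (f y)\<^sup>2"
        using fN[of y] N0[of y] C0 by (auto simp: indicator_def)
    qed
  qed measurable
  have "(\<lambda>n. complex_of_real (2 * pi * (LINT y|lborel. indicator {- real n..real n} y * f y * N y)))
    \<longlonglongrightarrow> complex_of_real (2 * pi * (LINT y|lborel. f y * N y))"
    by (intro tendsto_of_real tendsto_mult lim2 tendsto_const)
  also have "(\<lambda>n. complex_of_real (2 * pi * (LINT y|lborel. indicator {- real n..real n} y * f y * N y)))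
    = (\<lambda>n. LINT \<xi>|lborel. truncated_fourier n f \<xi> * w \<xi>)"
    unfolding w_def N_def truncated_fourier_gaussian_pairing[OF f k] integral_complex_of_real
    by simp
  finally show ?thesis
    using lim1 LIMSEQ_unique unfolding w_def N_def by blast
qed

text \<open>Only continuity and square integrability are given, so no sup bound on \<open>f\<close>
  is at hand. Near \<open>x\<close> continuity controls the error. Away from \<open>x\<close> the
  bound |f y - f x| <= (1 + |f x|) + (f y)^2 splits it: the constant is handled by the second moment
  of the Gaussian, as in Chebyshev's inequality, and the square by the uniform smallness of the
  density.\<close>

lemma gaussian_approximate_identity:
  assumes f: "continuous_on UNIV f" and f2: "integrable lborel (\<lambda>y. (f y)\<^sup>2)"
  shows "(\<lambda>n. LINT y|lborel. f y * normal_density x (1 / Suc n) y) \<longlonglongrightarrow> f x"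
proof -
  have [measurable]: "f \<in> borel_measurable borel"
    using f by (rule borel_measurable_continuous_onI)
  define N where "N n y = normal_density x (1 / Suc n) y" for n y
  define F where "F = (LINT y|lborel. (f y)\<^sup>2)"
  have Ni: "integrable lborel (N n)" and N1: "(LINT y|lborel. N n y) = 1" for n
    unfolding N_def[abs_def] by auto
  have Nv: "integrable lborel (\<lambda>y. N n y * (y - x)\<^sup>2)" for n
    unfolding N_def by (rule integrable_normal_moment) simp
  have Nv': "(LINT y|lborel. N n y * (y - x)\<^sup>2) = (1 / Suc n)\<^sup>2" for n
    using integral_normal_moment_even[of "1 / Suc n" x 1] unfolding N_def by (simp add: power_divide)
  have N0: "0 \<le> N n y" for n y by (simp add: N_def)
  \<comment> \<open>Uses exp (-t) <= 1/t with t = (k d)^2 / 2 and a peak height of at most k/2,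
    where \<open>k\<close> stands for \<open>Suc n\<close>. This crude decay in n already
    suffices.\<close>
  have Nfar: "N n y \<le> 1 / (real (Suc n) * d\<^sup>2)" if d: "d > 0" "d \<le> \<bar>y - x\<bar>" for n y d
  proof -
    have "real (Suc n) > 0" by simp
    then obtain k where kdef: "real (Suc n) = k" and k: "k > 0" by blast
    define t where "t = (k * d)\<^sup>2 / 2"
    have t: "t > 0" using d k by (simp add: t_def)
    have "d\<^sup>2 \<le> (y - x)\<^sup>2" using d abs_le_square_iff[of d "y - x"] by simp
    then have "t \<le> (y - x)\<^sup>2 / (2 * (1 / k)\<^sup>2)"
      using k by (simp add: t_def power_mult_distrib power_divide divide_right_mono mult_left_mono mult.commute[of 2])
    then have "exp (- (y - x)\<^sup>2 / (2 * (1 / k)\<^sup>2)) \<le> exp (- t)" by simp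
    also have "\<dots> \<le> 1 / t"
    proof -
      have "t \<le> exp t" using exp_ge_add_one_self[of t] by linarith
      then show ?thesis using t unfolding exp_minus inverse_eq_divide by (intro divide_left_mono) auto
    qed
    finally have e: "exp (- (y - x)\<^sup>2 / (2 * (1 / k)\<^sup>2)) \<le> 1 / t" .
    have "1 / sqrt (2 * pi * (1 / k)\<^sup>2) \<le> k / 2"
    proof -
      have "2 = sqrt (2 * 2)" by simp
      also have "\<dots> \<le> sqrt (2 * pi)" using pi_gt3 by (intro real_sqrt_le_mono) auto
      finally have "2 \<le> sqrt (2 * pi)" .
      then have "k / sqrt (2 * pi) \<le> k / 2" by (intro divide_left_mono) (use k in auto)
      moreover have "1 / sqrt (2 * pi * (1 / k)\<^sup>2) = k / sqrt (2 * pi)"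
        using k by (simp add: real_sqrt_mult real_sqrt_divide power_divide)
      ultimately show ?thesis by simp
    qed
    then have "N n y \<le> k / 2 * (1 / t)"
      unfolding N_def normal_density_def kdef using e k by (intro mult_mono) auto
    also have "\<dots> = 1 / (k * d\<^sup>2)" using k d by (simp add: t_def power_mult_distrib power2_eq_square)
    finally show ?thesis unfolding kdef .
  qed
  have fNi: "integrable lborel (\<lambda>y. f y * N n y)" for n
  proof (rule Bochner_Integration.integrable_bound)
    let ?C = "1 / sqrt (2 * pi * (1 / Suc n)\<^sup>2)"
    show "integrable lborel (\<lambda>y. N n y + ?C * (f y)\<^sup>2)" using Ni f2 by simp
    show "AE y in lborel. norm (f y * N n y) \<le> norm (N n y + ?C * (f y)\<^sup>2)"
    proof (intro always_eventually allI)
      fix y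
      have "N n y \<le> ?C" by (auto simp: N_def normal_density_def intro!: divide_right_mono)
      have "\<bar>f y\<bar> * N n y \<le> (1 + (f y)\<^sup>2) * N n y"
        using norm_le_one_plus_square[of "f y"] N0 by (intro mult_right_mono) auto
      also have "\<dots> \<le> N n y + ?C * (f y)\<^sup>2"
        using mult_right_mono[OF \<open>N n y \<le> ?C\<close>, of "(f y)\<^sup>2"] by (simp add: algebra_simps)
      finally show "norm (f y * N n y) \<le> norm (N n y + ?C * (f y)\<^sup>2)" using N0[of n y] by (simp add: abs_mult)
    qed
  qed (simp add: N_def)
  have est: "\<bar>(LINT y|lborel. f y * N n y) - f x\<bar> \<le> e + (1 + \<bar>f x\<bar>) / d\<^sup>2 * (1 / Suc n)\<^sup>2 + 1 / (real (Suc n) * d\<^sup>2) * F"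
    if d: "d > 0" and e: "e > 0" and cont: "\<And>y. \<bar>y - x\<bar> < d \<Longrightarrow> \<bar>f y - f x\<bar> < e" for d e n
  proof -
    have pw: "\<bar>f y * N n y - f x * N n y\<bar> \<le> e * N n y + (1 + \<bar>f x\<bar>) / d\<^sup>2 * (N n y * (y - x)\<^sup>2) + 1 / (real (Suc n) * d\<^sup>2) * (f y)\<^sup>2" for y
    proof (cases "\<bar>y - x\<bar> < d")
      case True
      have "\<bar>f y - f x\<bar> * N n y \<le> e * N n y" using cont[OF True] N0 by (intro mult_right_mono) auto
      moreover have "0 \<le> (1 + \<bar>f x\<bar>) / d\<^sup>2 * (N n y * (y - x)\<^sup>2)" "0 \<le> 1 / (real (Suc n) * d\<^sup>2) * (f y)\<^sup>2"
        using N0 by auto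
      moreover have "\<bar>f y * N n y - f x * N n y\<bar> = \<bar>f y - f x\<bar> * N n y"
        using N0 by (simp add: left_diff_distrib[symmetric] abs_mult)
      ultimately show ?thesis by linarith
    next
      case False
      then have dy: "d \<le> \<bar>y - x\<bar>" by simp
      then have "d\<^sup>2 \<le> (y - x)\<^sup>2" using d abs_le_square_iff[of d "y - x"] by simp
      then have q: "1 \<le> (y - x)\<^sup>2 / d\<^sup>2" using d by simp
      have "\<bar>f y\<bar> \<le> 1 + (f y)\<^sup>2" using norm_le_one_plus_square[of "f y"] by simp
      then have "\<bar>f y - f x\<bar> \<le> (1 + \<bar>f x\<bar>) + (f y)\<^sup>2" by linarith
      then have "\<bar>f y - f x\<bar> * N n y \<le> ((1 + \<bar>f x\<bar>) + (f y)\<^sup>2) * N n y" using N0 by (intro mult_right_mono)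
      then have 1: "\<bar>f y - f x\<bar> * N n y \<le> (1 + \<bar>f x\<bar>) * N n y + (f y)\<^sup>2 * N n y" unfolding distrib_right[of _ "(f y)\<^sup>2"] .
      have "(f y)\<^sup>2 * N n y \<le> (f y)\<^sup>2 * (1 / (real (Suc n) * d\<^sup>2))"
        using Nfar[OF d dy] by (intro mult_left_mono) auto
      then have 2: "(f y)\<^sup>2 * N n y \<le> 1 / (real (Suc n) * d\<^sup>2) * (f y)\<^sup>2" by (simp only: mult.commute)
      have "(1 + \<bar>f x\<bar>) * N n y * 1 \<le> (1 + \<bar>f x\<bar>) * N n y * ((y - x)\<^sup>2 / d\<^sup>2)"
        using q N0 by (intro mult_left_mono) auto
      also have "\<dots> = (1 + \<bar>f x\<bar>) / d\<^sup>2 * (N n y * (y - x)\<^sup>2)" by (simp only: times_divide_eq_right times_divide_eq_left mult.assoc)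
      finally have 3: "(1 + \<bar>f x\<bar>) * N n y \<le> (1 + \<bar>f x\<bar>) / d\<^sup>2 * (N n y * (y - x)\<^sup>2)" by (simp only: mult_1_right)
      have 4: "0 \<le> e * N n y" using e N0 by simp
      have 5: "\<bar>f y * N n y - f x * N n y\<bar> = \<bar>f y - f x\<bar> * N n y"
        using N0 by (simp add: left_diff_distrib[symmetric] abs_mult)
      show ?thesis using 1 2 3 4 unfolding 5 by linarith
    qed
    have "(LINT y|lborel. f y * N n y) - f x = (LINT y|lborel. f y * N n y - f x * N n y)"
      using fNi Ni N1 by (subst Bochner_Integration.integral_diff) auto
    also have "\<bar>\<dots>\<bar> \<le> (LINT y|lborel. \<bar>f y * N n y - f x * N n y\<bar>)" by (rule integral_abs_bound)
    also have "\<dots> \<le> (LINT y|lborel. e * N n y + (1 + \<bar>f x\<bar>) / d\<^sup>2 * (N n y * (y - x)\<^sup>2) + 1 / (real (Suc n) * d\<^sup>2) * (f y)\<^sup>2)"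
      using fNi Ni Nv f2 pw by (intro integral_mono) auto
    also have "\<dots> = e + (1 + \<bar>f x\<bar>) / d\<^sup>2 * (1 / Suc n)\<^sup>2 + 1 / (real (Suc n) * d\<^sup>2) * F"
      using Ni Nv f2 by (simp add: N1 Nv' F_def)
    finally show ?thesis .
  qed
  show ?thesis
  proof (rule tendstoI)
    fix e :: real assume e: "e > 0"
    obtain d where d: "d > 0" and cont: "\<And>y. \<bar>y - x\<bar> < d \<Longrightarrow> \<bar>f y - f x\<bar> < e / 2"
      
    proof -
      have "isCont f x" using f by (simp add: continuous_on_eq_continuous_at)
      then have "\<forall>\<^sub>F y in nhds x. dist (f y) (f x) < e / 2"
        using e by (intro tendstoD) (simp_all add: isCont_def tendsto_at_iff_tendsto_nhds)
      then show ?thesis using that by (auto simp: eventually_nhds_metric dist_real_def)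
    qed
    have "(\<lambda>n. e / 2 + (1 + \<bar>f x\<bar>) / d\<^sup>2 * (1 / Suc n)\<^sup>2 + 1 / d\<^sup>2 * F * (1 / Suc n))
      \<longlonglongrightarrow> e / 2 + (1 + \<bar>f x\<bar>) / d\<^sup>2 * 0\<^sup>2 + 1 / d\<^sup>2 * F * 0"
      using LIMSEQ_inverse_real_of_nat by (intro tendsto_intros) (simp_all add: inverse_eq_divide)
    then have "\<forall>\<^sub>F n in sequentially. e / 2 + (1 + \<bar>f x\<bar>) / d\<^sup>2 * (1 / Suc n)\<^sup>2 + 1 / d\<^sup>2 * F * (1 / Suc n) < e"
      by (rule order_tendstoD) (use e in simp)
    then show "\<forall>\<^sub>F n in sequentially. dist (LINT y|lborel. f y * normal_density x (1 / Suc n) y) (f x) < e"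
    proof eventually_elim
      case (elim n)
      have "1 / d\<^sup>2 * F * (1 / real (Suc n)) = 1 / (real (Suc n) * d\<^sup>2) * F" by simp
      then show ?case using est[OF d _ cont, of n] e elim unfolding N_def dist_real_def by linarith
    qed
  qed
qed

text \<open>For integrable \<open>g\<close> the Gaussian factor disappears by dominated convergence
  with majorant |g|, while the regularised side tends to \<open>f x\<close>. The transform is the
  non-unitary one, hence the factor 2 pi.\<close>

lemma fourier_inversion:
  assumes fg: "is_fourier f g" and f: "continuous_on UNIV f" and g: "integrable lborel g"
  shows "(LINT \<xi>|lborel. g \<xi> * cis (x * \<xi>)) = complex_of_real (2 * pi * f x)"
proof -
  have f2: "integrable lborel (\<lambda>y. (f y)\<^sup>2)" and [measurable]: "g \<in> borel_measurable borel"
    using fg by (auto simp: is_fourier_def square_integrable_def)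
  have "(\<lambda>n. LINT \<xi>|lborel. g \<xi> * (cis (x * \<xi>) * complex_of_real (exp (- (\<xi> / Suc n)\<^sup>2 / 2))))
    \<longlonglongrightarrow> (LINT \<xi>|lborel. g \<xi> * cis (x * \<xi>))"
  proof (rule integral_dominated_convergence[where w = "\<lambda>\<xi>. norm (g \<xi>)"])
    show "AE \<xi> in lborel. (\<lambda>n. g \<xi> * (cis (x * \<xi>) * complex_of_real (exp (- (\<xi> / Suc n)\<^sup>2 / 2)))) \<longlonglongrightarrow> g \<xi> * cis (x * \<xi>)"
    proof (intro always_eventually allI)
      fix \<xi>
      have "(\<lambda>n. exp (- (\<xi> * inverse (real (Suc n)))\<^sup>2 / 2)) \<longlonglongrightarrow> exp (- (\<xi> * 0)\<^sup>2 / 2)"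
        using LIMSEQ_inverse_real_of_nat by (intro tendsto_intros) auto
      then have "(\<lambda>n. exp (- (\<xi> / Suc n)\<^sup>2 / 2)) \<longlonglongrightarrow> 1"
        unfolding divide_inverse[of \<xi>] by simp
      then have "(\<lambda>n. g \<xi> * (cis (x * \<xi>) * complex_of_real (exp (- (\<xi> / Suc n)\<^sup>2 / 2)))) \<longlonglongrightarrow> g \<xi> * (cis (x * \<xi>) * complex_of_real 1)"
        by (intro tendsto_mult tendsto_const tendsto_of_real)
      then show "(\<lambda>n. g \<xi> * (cis (x * \<xi>) * complex_of_real (exp (- (\<xi> / Suc n)\<^sup>2 / 2)))) \<longlonglongrightarrow> g \<xi> * cis (x * \<xi>)" by simp
    qed
      show "AE \<xi> in lborel. norm (g \<xi> * (cis (x * \<xi>) * complex_of_real (exp (- (\<xi> / Suc n)\<^sup>2 / 2)))) \<le> norm (g \<xi>)" for n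
      by (intro always_eventually) (simp add: norm_mult mult_left_le)
    show "integrable lborel (\<lambda>\<xi>. norm (g \<xi>))" using g by simp
  qed measurable
  moreover have "(\<lambda>n. LINT \<xi>|lborel. g \<xi> * (cis (x * \<xi>) * complex_of_real (exp (- (\<xi> / Suc n)\<^sup>2 / 2))))
    = (\<lambda>n. complex_of_real (2 * pi * (LINT y|lborel. f y * normal_density x (1 / Suc n) y)))"
  proof
    fix n
    have "normal_density 0 (1 / Suc n) (x - y) = normal_density x (1 / Suc n) y" for y
      by (simp add: normal_density_def power2_commute)
    then show "(LINT \<xi>|lborel. g \<xi> * (cis (x * \<xi>) * complex_of_real (exp (- (\<xi> / Suc n)\<^sup>2 / 2))))
      = complex_of_real (2 * pi * (LINT y|lborel. f y * normal_density x (1 / Suc n) y))"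
      using fourier_gaussian_regularisation[OF fg f, of "Suc n" x] by simp
  qed
  moreover have "(\<lambda>n. complex_of_real (2 * pi * (LINT y|lborel. f y * normal_density x (1 / Suc n) y)))
    \<longlonglongrightarrow> complex_of_real (2 * pi * f x)"
    by (intro tendsto_intros gaussian_approximate_identity f f2)
  ultimately show ?thesis by (simp only: LIMSEQ_unique)
qed

section \<open>Sobolev functions of order at least two\<close>

lemma norm_cis_minus_one: "cmod (cis a - 1) \<le> \<bar>a\<bar>"
  using iexp_approx1[of a 0] by (simp add: cis_conv_exp)

lemma cis_difference_quotient:
  "((\<lambda>h. (cis (h * a) - 1) / complex_of_real h) \<longlongrightarrow> \<i> * complex_of_real a) (at 0)"
proof -
  have "((\<lambda>z. exp (\<i> * complex_of_real a * z)) has_field_derivative \<i> * complex_of_real a) (at 0)"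
    by (auto intro!: derivative_eq_intros)
  then have "((\<lambda>z. (exp (\<i> * complex_of_real a * z) - 1) / z) \<longlongrightarrow> \<i> * complex_of_real a) (at 0)"
    by (simp add: DERIV_def)
  moreover have "filterlim complex_of_real (at 0) (at 0)"
    unfolding filterlim_at by (auto simp: eventually_at_filter intro!: tendsto_eq_intros)
  ultimately have "((\<lambda>h. (exp (\<i> * complex_of_real a * complex_of_real h) - 1) / complex_of_real h) \<longlongrightarrow> \<i> * complex_of_real a) (at 0)"
    by (rule filterlim_compose)
  then show ?thesis by (simp add: cis_conv_exp mult_ac)
qed

lemma integrable_mult_cis:
  fixes G :: "real \<Rightarrow> complex"
  assumes "integrable lborel G"
  shows "integrable lborel (\<lambda>\<xi>. G \<xi> * cis (x * \<xi>))"
proof (rule Bochner_Integration.integrable_bound[OF assms])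
  have [measurable]: "G \<in> borel_measurable lborel" using assms by auto
  show "(\<lambda>\<xi>. G \<xi> * cis (x * \<xi>)) \<in> borel_measurable lborel" by measurable
qed (simp add: norm_mult)

text \<open>Differentiation under the integral sign: |cis a - 1| <= |a| bounds every difference
  quotient by |xi G|, uniformly in the increment. The limit is taken along sequences, the form in
  which dominated convergence applies.\<close>

lemma fourier_integral_difference_quotient:
  fixes G :: "real \<Rightarrow> complex"
  assumes G: "integrable lborel G" and G1: "integrable lborel (\<lambda>\<xi>. complex_of_real \<xi> * G \<xi>)"
  shows "((\<lambda>h. ((LINT \<xi>|lborel. G \<xi> * cis ((x + h) * \<xi>)) - (LINT \<xi>|lborel. G \<xi> * cis (x * \<xi>))) / complex_of_real h)
    \<longlongrightarrow> (LINT \<xi>|lborel. \<i> * complex_of_real \<xi> * G \<xi> * cis (x * \<xi>))) (at 0)"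
  unfolding tendsto_at_iff_sequentially
proof (intro allI impI)
  fix X :: "nat \<Rightarrow> real" assume X0: "\<forall>i. X i \<in> UNIV - {0}" and X: "X \<longlonglongrightarrow> 0"
  have [measurable]: "G \<in> borel_measurable lborel" using G by auto
  have lim: "(\<lambda>n. LINT \<xi>|lborel. G \<xi> * cis (x * \<xi>) * ((cis (X n * \<xi>) - 1) / complex_of_real (X n)))
    \<longlonglongrightarrow> (LINT \<xi>|lborel. \<i> * complex_of_real \<xi> * G \<xi> * cis (x * \<xi>))"
  proof (rule integral_dominated_convergence[where w = "\<lambda>\<xi>. norm (complex_of_real \<xi> * G \<xi>)"])
    show "AE \<xi> in lborel. (\<lambda>n. G \<xi> * cis (x * \<xi>) * ((cis (X n * \<xi>) - 1) / complex_of_real (X n)))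
      \<longlonglongrightarrow> \<i> * complex_of_real \<xi> * G \<xi> * cis (x * \<xi>)"
    proof (intro always_eventually allI)
      fix \<xi>
      have "(\<lambda>n. (cis (X n * \<xi>) - 1) / complex_of_real (X n)) \<longlonglongrightarrow> \<i> * complex_of_real \<xi>"
        using cis_difference_quotient[of \<xi>] X X0 unfolding tendsto_at_iff_sequentially comp_def by auto
      from tendsto_mult[OF tendsto_const this, of "G \<xi> * cis (x * \<xi>)"]
      show "(\<lambda>n. G \<xi> * cis (x * \<xi>) * ((cis (X n * \<xi>) - 1) / complex_of_real (X n)))
      \<longlonglongrightarrow> \<i> * complex_of_real \<xi> * G \<xi> * cis (x * \<xi>)" by (simp only: mult_ac)
    qed
    show "AE \<xi> in lborel. norm (G \<xi> * cis (x * \<xi>) * ((cis (X n * \<xi>) - 1) / complex_of_real (X n)))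
      \<le> norm (complex_of_real \<xi> * G \<xi>)" for n
    proof (intro always_eventually allI)
      fix \<xi>
      have "norm ((cis (X n * \<xi>) - 1) / complex_of_real (X n)) \<le> \<bar>\<xi>\<bar>"
        using norm_cis_minus_one[of "X n * \<xi>"] X0 by (simp add: norm_divide abs_mult field_simps)
      then have "norm (G \<xi>) * norm ((cis (X n * \<xi>) - 1) / complex_of_real (X n)) \<le> norm (G \<xi>) * \<bar>\<xi>\<bar>"
        by (intro mult_left_mono) auto
      then show "norm (G \<xi> * cis (x * \<xi>) * ((cis (X n * \<xi>) - 1) / complex_of_real (X n)))
        \<le> norm (complex_of_real \<xi> * G \<xi>)" unfolding norm_mult by (simp add: mult.commute)
    qed
    show "integrable lborel (\<lambda>\<xi>. norm (complex_of_real \<xi> * G \<xi>))" using G1 by (rule integrable_norm)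
  qed measurable
  have eq: "((LINT \<xi>|lborel. G \<xi> * cis ((x + X n) * \<xi>)) - (LINT \<xi>|lborel. G \<xi> * cis (x * \<xi>))) / complex_of_real (X n)
    = (LINT \<xi>|lborel. G \<xi> * cis (x * \<xi>) * ((cis (X n * \<xi>) - 1) / complex_of_real (X n)))" for n
  proof -
    have "(LINT \<xi>|lborel. G \<xi> * cis ((x + X n) * \<xi>)) - (LINT \<xi>|lborel. G \<xi> * cis (x * \<xi>))
      = (LINT \<xi>|lborel. G \<xi> * cis ((x + X n) * \<xi>) - G \<xi> * cis (x * \<xi>))"
      by (rule Bochner_Integration.integral_diff[symmetric]) (intro integrable_mult_cis G)+
    also have "\<dots> = (LINT \<xi>|lborel. complex_of_real (X n) * (G \<xi> * cis (x * \<xi>) * ((cis (X n * \<xi>) - 1) / complex_of_real (X n))))"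
    proof (intro Bochner_Integration.integral_cong refl)
      fix \<xi>
      have "cis ((x + X n) * \<xi>) = cis (x * \<xi>) * cis (X n * \<xi>)" by (simp add: cis_mult distrib_right)
      moreover have "complex_of_real (X n) \<noteq> 0" using X0 by auto
      ultimately show "G \<xi> * cis ((x + X n) * \<xi>) - G \<xi> * cis (x * \<xi>)
        = complex_of_real (X n) * (G \<xi> * cis (x * \<xi>) * ((cis (X n * \<xi>) - 1) / complex_of_real (X n)))"
        by (simp add: right_diff_distrib mult.assoc diff_divide_distrib)
    qed
    also have "\<dots> = complex_of_real (X n) * (LINT \<xi>|lborel. G \<xi> * cis (x * \<xi>) * ((cis (X n * \<xi>) - 1) / complex_of_real (X n)))"
      by (rule integral_mult_right_zero)
    finally show ?thesis using X0 by simp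
  qed
  show "((\<lambda>h. ((LINT \<xi>|lborel. G \<xi> * cis ((x + h) * \<xi>)) - (LINT \<xi>|lborel. G \<xi> * cis (x * \<xi>))) / complex_of_real h) \<circ> X)
    \<longlonglongrightarrow> (LINT \<xi>|lborel. \<i> * complex_of_real \<xi> * G \<xi> * cis (x * \<xi>))"
    unfolding comp_def eq by (rule lim)
qed

text \<open>Since cis (x xi) has modulus 1, the increment is bounded by the integral of |G| |cis (h
  xi) - 1|, which depends only on h = y - x and tends to 0 with h. One modulus thus serves all base
  points.\<close>

lemma fourier_integral_uniformly_continuous:
  fixes G :: "real \<Rightarrow> complex"
  assumes G: "integrable lborel G" and e: "e > 0"
  obtains d where "d > 0"
    "\<And>x y. \<bar>y - x\<bar> < d \<Longrightarrow> cmod ((LINT \<xi>|lborel. G \<xi> * cis (y * \<xi>)) - (LINT \<xi>|lborel. G \<xi> * cis (x * \<xi>))) < e"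
proof -
  have [measurable]: "G \<in> borel_measurable lborel" using G by auto
  define w where "w h = (LINT \<xi>|lborel. norm (G \<xi>) * cmod (cis (h * \<xi>) - 1))" for h
  have b2: "cmod (cis a - 1) \<le> 2" for a using norm_triangle_ineq4[of "cis a" 1] by simp
  have wi: "integrable lborel (\<lambda>\<xi>. norm (G \<xi>) * cmod (cis (h * \<xi>) - 1))" for h
  proof (rule Bochner_Integration.integrable_bound)
    show "integrable lborel (\<lambda>\<xi>. norm (G \<xi>) * 2)" using G by simp
    show "AE \<xi> in lborel. norm (norm (G \<xi>) * cmod (cis (h * \<xi>) - 1)) \<le> norm (norm (G \<xi>) * 2)"
      using b2 by (intro always_eventually) (auto intro!: mult_left_mono simp del: norm_mult simp: abs_mult)
  qed measurable
  have "(w \<longlongrightarrow> (LINT \<xi>::real|lborel. (0::real))) (at 0)"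
    unfolding tendsto_at_iff_sequentially
  proof (intro allI impI)
    fix X :: "nat \<Rightarrow> real" assume X: "X \<longlonglongrightarrow> 0"
    show "(w \<circ> X) \<longlonglongrightarrow> (LINT \<xi>::real|lborel. (0::real))"
      unfolding comp_def w_def
    proof (rule integral_dominated_convergence[where w = "\<lambda>\<xi>. norm (G \<xi>) * 2"])
      show "integrable lborel (\<lambda>\<xi>. norm (G \<xi>) * 2)" using G by simp
      show "AE \<xi> in lborel. (\<lambda>n. norm (G \<xi>) * cmod (cis (X n * \<xi>) - 1)) \<longlonglongrightarrow> 0"
      proof (intro always_eventually allI)
        fix \<xi>
        have "(\<lambda>n. cis (X n * \<xi>)) \<longlonglongrightarrow> cis (0 * \<xi>)" by (intro tendsto_intros X)
        then have "(\<lambda>n. norm (G \<xi>) * cmod (cis (X n * \<xi>) - 1)) \<longlonglongrightarrow> norm (G \<xi>) * cmod (cis (0 * \<xi>) - 1)"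
          by (intro tendsto_mult tendsto_const tendsto_norm tendsto_diff)
        then show "(\<lambda>n. norm (G \<xi>) * cmod (cis (X n * \<xi>) - 1)) \<longlonglongrightarrow> 0" by simp
      qed
      show "AE \<xi> in lborel. norm (norm (G \<xi>) * cmod (cis (X n * \<xi>) - 1)) \<le> norm (G \<xi>) * 2" for n
        using b2 by (intro always_eventually) (auto intro!: mult_left_mono simp: abs_mult)
    qed measurable
  qed
  then have "\<forall>\<^sub>F h in at 0. w h < e" by (intro order_tendstoD) (use e in auto)
  then obtain d where d: "d > 0" "\<And>h. h \<noteq> 0 \<Longrightarrow> \<bar>h\<bar> < d \<Longrightarrow> w h < e"
    unfolding eventually_at by (auto simp: dist_real_def)
  have "w 0 < e" using e by (simp add: w_def)
  then have dw: "w h < e" if "\<bar>h\<bar> < d" for h using d that by (cases "h = 0") auto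
  show ?thesis
  proof (rule that[OF d(1)])
    fix x y :: real assume xy: "\<bar>y - x\<bar> < d"
    have "(LINT \<xi>|lborel. G \<xi> * cis (y * \<xi>)) - (LINT \<xi>|lborel. G \<xi> * cis (x * \<xi>))
      = (LINT \<xi>|lborel. G \<xi> * cis (y * \<xi>) - G \<xi> * cis (x * \<xi>))"
      by (rule Bochner_Integration.integral_diff[symmetric]) (intro integrable_mult_cis G)+
    also have "cmod \<dots> \<le> (LINT \<xi>|lborel. cmod (G \<xi> * cis (y * \<xi>) - G \<xi> * cis (x * \<xi>)))" by (rule integral_norm_bound)
    also have "\<dots> = w (y - x)"
      unfolding w_def
    proof (intro Bochner_Integration.integral_cong refl)
      fix \<xi>
      have "cis (y * \<xi>) = cis (x * \<xi>) * cis ((y - x) * \<xi>)" by (simp add: cis_mult algebra_simps)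
      then have "G \<xi> * cis (y * \<xi>) - G \<xi> * cis (x * \<xi>) = G \<xi> * (cis (x * \<xi>) * (cis ((y - x) * \<xi>) - 1))"
        by (simp add: algebra_simps)
      then show "cmod (G \<xi> * cis (y * \<xi>) - G \<xi> * cis (x * \<xi>)) = norm (G \<xi>) * cmod (cis ((y - x) * \<xi>) - 1)"
        by (simp add: norm_mult)
    qed
    also have "\<dots> < e" by (rule dw[OF xy])
    finally show "cmod ((LINT \<xi>|lborel. G \<xi> * cis (y * \<xi>)) - (LINT \<xi>|lborel. G \<xi> * cis (x * \<xi>))) < e" .
  qed
qed

section \<open>Embedding of the Sobolev space into continuously differentiable functions\<close>

lemma sobolev_fourier:
  assumes "f \<in> sobolev s"
  shows "continuous_on UNIV f" "is_fourier f (fourier f)"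
    "integrable lborel (\<lambda>\<xi>. (1 + \<xi>\<^sup>2) powr s * (cmod (fourier f \<xi>))\<^sup>2)"
proof -
  obtain g where g: "is_fourier f g" and gi: "integrable lborel (\<lambda>\<xi>. (1 + \<xi>\<^sup>2) powr s * (cmod (g \<xi>))\<^sup>2)"
    and "continuous_on UNIV f" using assms by (auto simp: sobolev_def)
  then show "continuous_on UNIV f" by simp
  show fou: "is_fourier f (fourier f)" unfolding fourier_def using g by (rule someI[of "is_fourier f"])
  have [measurable]: "g \<in> borel_measurable lborel" "fourier f \<in> borel_measurable lborel"
    using g fou by (auto simp: is_fourier_def square_integrable_def)
  \<comment> \<open>Membership gives this bound for some transform \<open>g\<close>; almost
    everywhere uniqueness passes it on to the chosen representative
    \<open>fourier f\<close>.\<close>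
  show "integrable lborel (\<lambda>\<xi>. (1 + \<xi>\<^sup>2) powr s * (cmod (fourier f \<xi>))\<^sup>2)"
  proof (subst integrable_cong_AE)
    show "AE \<xi> in lborel. (1 + \<xi>\<^sup>2) powr s * (cmod (fourier f \<xi>))\<^sup>2 = (1 + \<xi>\<^sup>2) powr s * (cmod (g \<xi>))\<^sup>2"
      using is_fourier_AE_unique[OF fou g] by eventually_elim simp
  qed (use gi in measurable)
qed

text \<open>The embedding of H^s into C^1 seen on the frequency side: it supplies the integrability
  that inversion and one differentiation require. The constant 2 pi will cancel that of the
  inversion formula, so that the later sup bounds hold with constant 1.\<close>

lemma sobolev_fourier_weighted_L1:
  assumes s: "s \<ge> 2" and f: "f \<in> sobolev s"
  shows "integrable lborel (\<lambda>\<xi>. (1 + \<bar>\<xi>\<bar>) * cmod (fourier f \<xi>))"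
    "(LINT \<xi>|lborel. (1 + \<bar>\<xi>\<bar>) * cmod (fourier f \<xi>)) \<le> 2 * pi * sobolev_norm s f"
proof -
  let ?G = "fourier f"
  define W where "W \<xi> = (1 + \<xi>\<^sup>2) powr s * (cmod (?G \<xi>))\<^sup>2" for \<xi>
  have Wi: "integrable lborel W" using sobolev_fourier(3)[OF f] by (simp add: W_def[abs_def])
  have [measurable]: "?G \<in> borel_measurable lborel"
    using sobolev_fourier(2)[OF f] by (auto simp: is_fourier_def square_integrable_def)
  have qi: "integrable lborel (\<lambda>\<xi>::real. inverse (1 + \<xi>\<^sup>2))" and q: "(LINT \<xi>::real|lborel. inverse (1 + \<xi>\<^sup>2)) = pi"
    using integrable_inverse_1_plus_square LBINT_inverse_1_plus_square
    by (simp_all add: set_integrable_def interval_lebesgue_integral_def set_lebesgue_integral_def)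
  \<comment> \<open>AM-GM in place of Cauchy--Schwarz; the parameter \<open>k\<close> is set to the Sobolev norm at the end.\<close>
  have pw: "(1 + \<bar>\<xi>\<bar>) * cmod (?G \<xi>) \<le> k * inverse (1 + \<xi>\<^sup>2) + (1/k) * W \<xi>" if k: "k > 0" for k \<xi> :: real
  proof -
    define r where "r = 1 + \<xi>\<^sup>2"
    have r: "r \<ge> 1" by (simp add: r_def)
    let ?a = "1 + \<bar>\<xi>\<bar>" and ?g = "cmod (?G \<xi>)"
    have "?a\<^sup>2 \<le> 2 * r" using zero_le_power2[of "\<bar>\<xi>\<bar> - 1"] by (simp add: r_def power2_eq_square algebra_simps)
    have "r\<^sup>2 \<le> r powr s"
      using s r powr_mono[of 2 s r] by (simp add: powr_numeral)
    \<comment> \<open>The factor r^2 is matched to both squares: after division by 2 k r^2 the first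
      leaves a multiple of 1/r, as \<open>?a\<close> squared is at most 2 r, and the second a
      multiple of \<open>W\<close>, as r^2 <= \<open>r powr s\<close>.\<close>
    have "0 \<le> (k * ?a - r\<^sup>2 * ?g)\<^sup>2" by simp
    then have "2 * k * r\<^sup>2 * (?a * ?g) \<le> k\<^sup>2 * ?a\<^sup>2 + r\<^sup>2 * (r\<^sup>2 * ?g\<^sup>2)"
      by (simp add: power2_eq_square algebra_simps)
    also have "\<dots> \<le> k\<^sup>2 * (2 * r) + r\<^sup>2 * (r powr s * ?g\<^sup>2)"
      using \<open>?a\<^sup>2 \<le> 2 * r\<close> \<open>r\<^sup>2 \<le> r powr s\<close> by (intro add_mono mult_left_mono mult_right_mono) auto
    also have "r powr s * ?g\<^sup>2 = W \<xi>" by (simp add: W_def r_def)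
    also have "k\<^sup>2 * (2 * r) + r\<^sup>2 * W \<xi> = 2 * k * r\<^sup>2 * (k * inverse r + (1 / (2 * k)) * W \<xi>)"
      using k r by (simp add: power2_eq_square field_simps)
    finally have "2 * k * r\<^sup>2 * (?a * ?g) \<le> 2 * k * r\<^sup>2 * (k * inverse r + (1 / (2 * k)) * W \<xi>)" .
    then have "?a * ?g \<le> k * inverse r + (1 / (2 * k)) * W \<xi>"
      using k r by (subst (asm) mult_le_cancel_left_pos) auto
    also have "(1 / (2 * k)) * W \<xi> \<le> (1 / k) * W \<xi>"
      using k by (intro mult_right_mono) (auto simp: W_def frac_le)
    finally show ?thesis by (simp add: r_def)
  qed
  have dom: "integrable lborel (\<lambda>\<xi>. k * inverse (1 + \<xi>\<^sup>2) + (1/k) * W \<xi>)" for k :: real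
    using qi Wi by simp
  show int: "integrable lborel (\<lambda>\<xi>. (1 + \<bar>\<xi>\<bar>) * cmod (?G \<xi>))"
  proof (rule Bochner_Integration.integrable_bound[OF dom[of 1]])
    show "AE \<xi> in lborel. norm ((1 + \<bar>\<xi>\<bar>) * cmod (?G \<xi>)) \<le> norm (1 * inverse (1 + \<xi>\<^sup>2) + (1/1) * W \<xi>)"
    proof (intro always_eventually allI)
      fix \<xi>
      have "norm ((1 + \<bar>\<xi>\<bar>) * cmod (?G \<xi>)) = (1 + \<bar>\<xi>\<bar>) * cmod (?G \<xi>)" by (simp add: abs_mult)
      also have "\<dots> \<le> norm (1 * inverse (1 + \<xi>\<^sup>2) + (1/1) * W \<xi>)" using pw[of 1 \<xi>] by simp
      finally show "norm ((1 + \<bar>\<xi>\<bar>) * cmod (?G \<xi>)) \<le> norm (1 * inverse (1 + \<xi>\<^sup>2) + (1/1) * W \<xi>)" .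
    qed
  qed measurable
  define I where "I = (LINT \<xi>|lborel. (1 + \<bar>\<xi>\<bar>) * cmod (?G \<xi>))"
  define N where "N = sobolev_norm s f"
  have N0: "N \<ge> 0" by (simp add: N_def sobolev_norm_def)
  have NW: "N\<^sup>2 = (LINT \<xi>|lborel. W \<xi>)"
    unfolding N_def sobolev_norm_def W_def by (rule real_sqrt_pow2) (auto intro!: integral_nonneg_AE)
  have Ik: "I \<le> k * pi + (1/k) * N\<^sup>2" if k: "k > 0" for k
  proof -
    have "I \<le> (LINT \<xi>|lborel. k * inverse (1 + \<xi>\<^sup>2) + (1/k) * W \<xi>)"
      unfolding I_def by (intro integral_mono int dom pw k)
    also have "\<dots> = k * pi + (1/k) * N\<^sup>2"
      using qi Wi by (simp add: NW q)
    finally show ?thesis .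
  qed
  have "I \<le> 2 * pi * N"
  proof (cases "N = 0")
    \<comment> \<open>The choice k = N is barred here; letting k tend to 0 instead shows that the
      integral is at most 0.\<close>
    case True
    have "I \<le> 0 + e" if "e > 0" for e using Ik[of "e / pi"] that True by simp
    then have "I \<le> 0" by (rule field_le_epsilon)
    then show ?thesis using True by simp
  next
    case False
    then have "N > 0" using N0 by simp
    then have "I \<le> N * pi + N" using Ik[of N] by (simp add: power2_eq_square)
    also have "\<dots> \<le> 2 * pi * N" using \<open>N > 0\<close> pi_gt3 mult_right_mono[of 1 pi N] by simp
    finally show ?thesis .
  qed
  then show "(LINT \<xi>|lborel. (1 + \<bar>\<xi>\<bar>) * cmod (?G \<xi>)) \<le> 2 * pi * sobolev_norm s f"
    by (simp add: I_def N_def)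
qed

text \<open>By inversion \<open>f\<close> is a Fourier integral whose density has an integrable
  first moment, so it can be differentiated under the integral. Both sup bounds come from the
  weighted L^1 norm, and the last claim from the uniform continuity of the Fourier integral of xi
  G.\<close>

lemma sobolev_C1:
  assumes s: "s \<ge> 2" and f: "f \<in> sobolev s"
  shows "(f has_real_derivative deriv f x) (at x)"
    "\<bar>f x\<bar> \<le> sobolev_norm s f" "\<bar>deriv f x\<bar> \<le> sobolev_norm s f"
    "e > 0 \<Longrightarrow> \<exists>d>0. \<forall>x y. \<bar>y - x\<bar> < d \<longrightarrow> \<bar>deriv f y - deriv f x\<bar> < e"
proof -
  let ?G = "fourier f"
  have [measurable]: "?G \<in> borel_measurable lborel"
    using sobolev_fourier(2)[OF f] by (auto simp: is_fourier_def square_integrable_def)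
  note L1 = sobolev_fourier_weighted_L1[OF s f]
  have G: "integrable lborel ?G"
    by (rule Bochner_Integration.integrable_bound[OF L1(1)])
      (auto simp: abs_mult distrib_right)
  have G1: "integrable lborel (\<lambda>\<xi>. complex_of_real \<xi> * ?G \<xi>)"
    by (rule Bochner_Integration.integrable_bound[OF L1(1)])
      (auto simp: abs_mult distrib_right norm_mult)
  define H where "H x = (LINT \<xi>|lborel. ?G \<xi> * cis (x * \<xi>))" for x
  define D where "D x = (LINT \<xi>|lborel. \<i> * complex_of_real \<xi> * ?G \<xi> * cis (x * \<xi>))" for x
  have H: "H x = complex_of_real (2 * pi * f x)" for x
    unfolding H_def by (rule fourier_inversion[OF sobolev_fourier(2,1)[OF f] G])
  have iG1: "integrable lborel (\<lambda>\<xi>. \<i> * complex_of_real \<xi> * ?G \<xi>)"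
    using integrable_mult_right[OF G1, of \<i>] by (simp only: mult.assoc)
  \<comment> \<open>Real parts are taken because \<open>D x\<close> is a complex integral while
    \<open>f\<close> is real valued.\<close>
  have der: "(f has_real_derivative Re (D x) / (2 * pi)) (at x)" for x
  proof -
    have "((\<lambda>h. (H (x + h) - H x) / complex_of_real h) \<longlongrightarrow> D x) (at 0)"
      unfolding H_def D_def by (rule fourier_integral_difference_quotient[OF G G1])
    from tendsto_divide[OF tendsto_Re[OF this] tendsto_const, of "2 * pi"]
    have "((\<lambda>h. Re ((H (x + h) - H x) / complex_of_real h) / (2 * pi)) \<longlongrightarrow> Re (D x) / (2 * pi)) (at 0)"
      by simp
    moreover have "Re ((H (x + h) - H x) / complex_of_real h) / (2 * pi) = (f (x + h) - f x) / h" for h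
    proof -
      have "(H (x + h) - H x) / complex_of_real h = complex_of_real (2 * pi * ((f (x + h) - f x) / h))"
        unfolding H by (simp add: right_diff_distrib diff_divide_distrib)
      then show ?thesis by (simp only: Re_complex_of_real) simp
    qed
    ultimately show ?thesis by (simp add: DERIV_def)
  qed
  have dD: "deriv f x = Re (D x) / (2 * pi)" for x by (rule DERIV_imp_deriv[OF der])
  show "(f has_real_derivative deriv f x) (at x)" unfolding dD by (rule der)
  show "\<bar>f x\<bar> \<le> sobolev_norm s f"
  proof -
    have "2 * pi * \<bar>f x\<bar> = cmod (H x)" unfolding H by (simp add: abs_mult norm_mult)
    also have "\<dots> \<le> (LINT \<xi>|lborel. cmod (?G \<xi> * cis (x * \<xi>)))" unfolding H_def by (rule integral_norm_bound)
    also have "\<dots> \<le> (LINT \<xi>|lborel. (1 + \<bar>\<xi>\<bar>) * cmod (?G \<xi>))"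
      using G L1(1) by (intro integral_mono) (auto simp: norm_mult distrib_right)
    also have "\<dots> \<le> 2 * pi * sobolev_norm s f" by (rule L1(2))
    finally show ?thesis by simp
  qed
  show "\<bar>deriv f x\<bar> \<le> sobolev_norm s f"
  proof -
    have "2 * pi * \<bar>deriv f x\<bar> = \<bar>Re (D x)\<bar>" unfolding dD by simp
    also have "\<dots> \<le> cmod (D x)" by (rule abs_Re_le_cmod)
    also have "\<dots> \<le> (LINT \<xi>|lborel. cmod (\<i> * complex_of_real \<xi> * ?G \<xi> * cis (x * \<xi>)))"
      unfolding D_def by (rule integral_norm_bound)
    also have "\<dots> \<le> (LINT \<xi>|lborel. (1 + \<bar>\<xi>\<bar>) * cmod (?G \<xi>))"
      using integrable_norm[OF G1] L1(1) by (intro integral_mono) (auto simp: norm_mult distrib_right)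
    also have "\<dots> \<le> 2 * pi * sobolev_norm s f" by (rule L1(2))
    finally show ?thesis by simp
  qed
  assume e: "e > 0"
  have e': "2 * pi * e > 0" using e by simp
  obtain d where d: "d > 0" and dd: "\<And>x y. \<bar>y - x\<bar> < d \<Longrightarrow> cmod (D y - D x) < 2 * pi * e"
    unfolding D_def using fourier_integral_uniformly_continuous[OF iG1 e'] by blast
  have "\<bar>deriv f y - deriv f x\<bar> < e" if "\<bar>y - x\<bar> < d" for x y
  proof -
    have "\<bar>Re (D y - D x)\<bar> < 2 * pi * e" using abs_Re_le_cmod dd[OF that] by (rule le_less_trans)
    moreover have "\<bar>deriv f y - deriv f x\<bar> = \<bar>Re (D y - D x)\<bar> / (2 * pi)"
      unfolding dD by (simp add: diff_divide_distrib[symmetric])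
    ultimately show ?thesis by (simp add: divide_less_eq mult.commute)
  qed
  then show "\<exists>d>0. \<forall>x y. \<bar>y - x\<bar> < d \<longrightarrow> \<bar>deriv f y - deriv f x\<bar> < e" using d by blast
qed

text \<open>Continuity in time is expressed through the norm of u(tau) - u(t), and the pointwise
  bounds apply to this difference once it lies in the space. Integrability and the L^2 limit follow
  from linearity and |a - b|^2 <= 2 |a|^2 + 2 |b|^2.\<close>

lemma sobolev_diff:
  assumes f: "f \<in> sobolev s" and h: "h \<in> sobolev s"
  shows "(\<lambda>x. f x - h x) \<in> sobolev s"
proof -
  note F = sobolev_fourier[OF f] and H = sobolev_fourier[OF h]
  have ff: "square_integrable f" "square_integrable h" "square_integrable (fourier f)" "square_integrable (fourier h)"
    using F(2) H(2) by (auto simp: is_fourier_def)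
  then have [measurable]: "f \<in> borel_measurable lborel" "h \<in> borel_measurable lborel"
    "fourier f \<in> borel_measurable lborel" "fourier h \<in> borel_measurable lborel"
    by (auto simp: square_integrable_def)
  define k where "k \<xi> = fourier f \<xi> - fourier h \<xi>" for \<xi>
  have kb: "(cmod (k \<xi>))\<^sup>2 \<le> 2 * (cmod (fourier f \<xi>))\<^sup>2 + 2 * (cmod (fourier h \<xi>))\<^sup>2" for \<xi>
    unfolding k_def by (rule cmod_diff_square_le)
  have [measurable]: "k \<in> borel_measurable lborel" unfolding k_def[abs_def] by measurable
  have sk: "square_integrable k"
    unfolding square_integrable_def
  proof
    show "integrable lborel (\<lambda>x. (norm (k x))\<^sup>2)"
    proof (rule Bochner_Integration.integrable_bound)
      show "integrable lborel (\<lambda>\<xi>. 2 * (cmod (fourier f \<xi>))\<^sup>2 + 2 * (cmod (fourier h \<xi>))\<^sup>2)"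
        using ff by (simp add: square_integrable_def)
      show "AE \<xi> in lborel. norm ((norm (k \<xi>))\<^sup>2) \<le> norm (2 * (cmod (fourier f \<xi>))\<^sup>2 + 2 * (cmod (fourier h \<xi>))\<^sup>2)"
        using kb by (intro always_eventually) auto
    qed measurable
  qed measurable
  have sd: "square_integrable (\<lambda>x. f x - h x)"
    unfolding square_integrable_def
  proof
    show "integrable lborel (\<lambda>x. (norm (f x - h x))\<^sup>2)"
    proof (rule Bochner_Integration.integrable_bound)
      show "integrable lborel (\<lambda>x. 2 * (f x)\<^sup>2 + 2 * (h x)\<^sup>2)"
        using ff by (simp add: square_integrable_def)
      show "AE x in lborel. norm ((norm (f x - h x))\<^sup>2) \<le> norm (2 * (f x)\<^sup>2 + 2 * (h x)\<^sup>2)"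
      proof (intro always_eventually allI)
        fix x
        show "norm ((norm (f x - h x))\<^sup>2) \<le> norm (2 * (f x)\<^sup>2 + 2 * (h x)\<^sup>2)"
          using cmod_diff_square_le[of "complex_of_real (f x)" "complex_of_real (h x)"]
          by (simp flip: of_real_diff)
      qed
    qed measurable
  qed measurable
  \<comment> \<open>Splitting the truncated integrals requires integrability on the compact
    interval, which continuity provides.\<close>
  have trunc: "truncated_fourier n (\<lambda>x. f x - h x) \<xi> = truncated_fourier n f \<xi> - truncated_fourier n h \<xi>" for n \<xi>
  proof -
    have "set_integrable lborel {- real n..real n} (\<lambda>x. complex_of_real (v x) * cis (- (\<xi> * x)))"
      if "continuous_on UNIV v" for v
      unfolding set_integrable_def
      by (intro borel_integrable_compact) (auto intro!: continuous_intros continuous_on_subset[OF that])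
    note this[OF F(1)] this[OF H(1)]
    from set_integral_diff(2)[OF this] show ?thesis
      unfolding truncated_fourier_def by (simp add: left_diff_distrib)
  qed
  let ?A = "\<lambda>n. \<integral>\<^sup>+\<xi>. ennreal ((cmod (truncated_fourier n f \<xi> - fourier f \<xi>))\<^sup>2) \<partial>lborel"
  let ?B = "\<lambda>n. \<integral>\<^sup>+\<xi>. ennreal ((cmod (truncated_fourier n h \<xi> - fourier h \<xi>))\<^sup>2) \<partial>lborel"
  let ?C = "\<lambda>n. \<integral>\<^sup>+\<xi>. ennreal ((cmod (truncated_fourier n (\<lambda>x. f x - h x) \<xi> - k \<xi>))\<^sup>2) \<partial>lborel"
  have CAB: "?C n \<le> 2 * ?A n + 2 * ?B n" for n
  proof -
    have "?C n \<le> (\<integral>\<^sup>+\<xi>. 2 * ennreal ((cmod (truncated_fourier n f \<xi> - fourier f \<xi>))\<^sup>2)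
      + 2 * ennreal ((cmod (truncated_fourier n h \<xi> - fourier h \<xi>))\<^sup>2) \<partial>lborel)"
    proof (rule nn_integral_mono)
      fix \<xi>
      let ?a = "truncated_fourier n f \<xi> - fourier f \<xi>" and ?b = "truncated_fourier n h \<xi> - fourier h \<xi>"
      have "truncated_fourier n (\<lambda>x. f x - h x) \<xi> - k \<xi> = ?a - ?b" by (simp add: trunc k_def)
      then have "ennreal ((cmod (truncated_fourier n (\<lambda>x. f x - h x) \<xi> - k \<xi>))\<^sup>2) \<le> ennreal (2 * (cmod ?a)\<^sup>2 + 2 * (cmod ?b)\<^sup>2)"
        using cmod_diff_square_le[of ?a ?b] by (intro ennreal_leI) simp
      then show "ennreal ((cmod (truncated_fourier n (\<lambda>x. f x - h x) \<xi> - k \<xi>))\<^sup>2) \<le> 2 * ennreal ((cmod ?a)\<^sup>2) + 2 * ennreal ((cmod ?b)\<^sup>2)"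
        by (simp add: ennreal_mult'')
    qed
    also have "\<dots> = 2 * ?A n + 2 * ?B n"
      by (subst nn_integral_add) (auto simp: nn_integral_cmult)
    finally show ?thesis .
  qed
  have "(\<lambda>n. 2 * ?A n + 2 * ?B n) \<longlonglongrightarrow> 2 * 0 + 2 * 0"
    using F(2) H(2) by (intro tendsto_add ennreal_tendsto_cmult) (auto simp: is_fourier_def)
  then have "(\<lambda>n. 2 * ?A n + 2 * ?B n) \<longlonglongrightarrow> 0" by simp
  then have "?C \<longlonglongrightarrow> 0"
    by (rule tendsto_sandwich[OF _ _ tendsto_const, rotated -1]) (use CAB in auto)
  then have fk: "is_fourier (\<lambda>x. f x - h x) k"
    using sk sd by (simp add: is_fourier_def)
  have "integrable lborel (\<lambda>\<xi>. (1 + \<xi>\<^sup>2) powr s * (cmod (k \<xi>))\<^sup>2)"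
  proof (rule Bochner_Integration.integrable_bound)
    let ?w = "\<lambda>\<xi>::real. (1 + \<xi>\<^sup>2) powr s"
    show "integrable lborel (\<lambda>\<xi>. 2 * (?w \<xi> * (cmod (fourier f \<xi>))\<^sup>2) + 2 * (?w \<xi> * (cmod (fourier h \<xi>))\<^sup>2))"
      using F(3) H(3) by simp
    show "AE \<xi> in lborel. norm (?w \<xi> * (cmod (k \<xi>))\<^sup>2) \<le> norm (2 * (?w \<xi> * (cmod (fourier f \<xi>))\<^sup>2) + 2 * (?w \<xi> * (cmod (fourier h \<xi>))\<^sup>2))"
    proof (intro always_eventually allI)
      fix \<xi>
      have "?w \<xi> * (cmod (k \<xi>))\<^sup>2 \<le> ?w \<xi> * (2 * (cmod (fourier f \<xi>))\<^sup>2 + 2 * (cmod (fourier h \<xi>))\<^sup>2)"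
        by (intro mult_left_mono kb) auto
      also have "\<dots> = 2 * (?w \<xi> * (cmod (fourier f \<xi>))\<^sup>2) + 2 * (?w \<xi> * (cmod (fourier h \<xi>))\<^sup>2)"
        by (simp add: distrib_left)
      finally show "norm (?w \<xi> * (cmod (k \<xi>))\<^sup>2) \<le> norm (2 * (?w \<xi> * (cmod (fourier f \<xi>))\<^sup>2) + 2 * (?w \<xi> * (cmod (fourier h \<xi>))\<^sup>2))"
        by (simp add: abs_mult)
    qed
  qed measurable
  moreover have "continuous_on UNIV (\<lambda>x. f x - h x)" using F(1) H(1) by (intro continuous_intros)
  ultimately show ?thesis using fk by (auto simp: sobolev_def)
qed

lemma sobolev_lipschitz:
  assumes s: "s \<ge> 2" and f: "f \<in> sobolev s"
  shows "\<bar>f y - f x\<bar> \<le> sobolev_norm s f * \<bar>y - x\<bar>"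
proof -
  have "norm (f y - f x) \<le> sobolev_norm s f * norm (y - x)"
    by (rule field_differentiable_bound[of UNIV f "deriv f"])
      (use sobolev_C1(1,3)[OF s f] in \<open>auto simp: has_field_derivative_at_within\<close>)
  then show ?thesis by simp
qed

text \<open>If |f x| >= e, the Lipschitz bound keeps |f| above e/2 within distance r = e / (2 L) of
  \<open>x\<close>. This contributes 2 r (e/2)^2 = r e^2 / 2 to the integral of f^2, more than the
  tail can supply.\<close>

lemma sobolev_vanishes_at_infinity:
  assumes s: "s \<ge> 2" and f: "f \<in> sobolev s" and e: "e > 0"
  shows "\<exists>R. \<forall>x. \<bar>x\<bar> > R \<longrightarrow> \<bar>f x\<bar> < e"
proof -
  have [measurable]: "f \<in> borel_measurable borel" and f2: "integrable lborel (\<lambda>y. (f y)\<^sup>2)"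
    using sobolev_fourier(2)[OF f] by (auto simp: is_fourier_def square_integrable_def)
  \<comment> \<open>The added 1 keeps the Lipschitz constant positive when the norm is 0, so that
    division by \<open>L\<close> is safe.\<close>
  define L where "L = sobolev_norm s f + 1"
  have N0: "sobolev_norm s f \<ge> 0" by (simp add: sobolev_norm_def)
  then have L: "L > 0" by (simp add: L_def)
  have lip: "\<bar>f y - f x\<bar> \<le> L * \<bar>y - x\<bar>" for x y
    using sobolev_lipschitz[OF s f, of y x] by (simp add: L_def distrib_right add_increasing2)
  define r where "r = e / (2 * L)"
  have r: "r > 0" using e L by (simp add: r_def)
  have "(\<lambda>n. LINT y|lborel. indicator {y. \<bar>y\<bar> \<ge> real n} y * (f y)\<^sup>2) \<longlonglongrightarrow> (LINT y::real|lborel. (0::real))"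
  proof (rule integral_dominated_convergence[OF _ _ f2])
    show "AE y in lborel. (\<lambda>n. indicator {y. \<bar>y\<bar> \<ge> real n} y * (f y)\<^sup>2) \<longlonglongrightarrow> 0"
    proof (intro always_eventually allI)
      fix y
      have "\<forall>\<^sub>F n in sequentially. \<bar>y\<bar> < real n"
        using eventually_gt_at_top[of "nat \<lceil>\<bar>y\<bar>\<rceil>"] by eventually_elim linarith
      then have "\<forall>\<^sub>F n in sequentially. indicator {y. \<bar>y\<bar> \<ge> real n} y * (f y)\<^sup>2 = 0"
        by eventually_elim auto
      then show "(\<lambda>n. indicator {y. \<bar>y\<bar> \<ge> real n} y * (f y)\<^sup>2) \<longlonglongrightarrow> 0" by (rule tendsto_eventually)
    qed
    show "AE y in lborel. norm (indicator {y. \<bar>y\<bar> \<ge> real n} y * (f y)\<^sup>2) \<le> (f y)\<^sup>2" for n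
      by (intro always_eventually) (auto simp: indicator_def)
  qed measurable
  then have "\<forall>\<^sub>F n in sequentially. (LINT y|lborel. indicator {y. \<bar>y\<bar> \<ge> real n} y * (f y)\<^sup>2) < r * e\<^sup>2 / 2"
    by (rule order_tendstoD) (use r e in simp)
  then obtain n where n: "(LINT y|lborel. indicator {y. \<bar>y\<bar> \<ge> real n} y * (f y)\<^sup>2) < r * e\<^sup>2 / 2"
    by (auto simp: eventually_sequentially)
  have ni: "integrable lborel (\<lambda>y. indicator {y. \<bar>y\<bar> \<ge> real n} y * (f y)\<^sup>2)"
    by (rule Bochner_Integration.integrable_bound[OF f2]) (auto simp: indicator_def)
  have "\<bar>f x\<bar> < e" if x: "\<bar>x\<bar> > real n + r" for x
  proof (rule ccontr)
    assume "\<not> \<bar>f x\<bar> < e"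
    then have fx: "\<bar>f x\<bar> \<ge> e" by simp
    have "r * e\<^sup>2 / 2 = (LINT y|lborel. indicator {x - r..x + r} y * (e / 2)\<^sup>2)"
      using r by (simp add: power2_eq_square)
    also have "\<dots> \<le> (LINT y|lborel. indicator {y. \<bar>y\<bar> \<ge> real n} y * (f y)\<^sup>2)"
    proof (rule integral_mono[OF _ ni])
      show "integrable lborel (\<lambda>y. indicator {x - r..x + r} y * (e / 2)\<^sup>2)"
        using r by (intro integrable_mult_left integrable_real_indicator) auto
      fix y
      show "indicator {x - r..x + r} y * (e / 2)\<^sup>2 \<le> indicator {y. \<bar>y\<bar> \<ge> real n} y * (f y)\<^sup>2"
      proof (cases "y \<in> {x - r..x + r}")
        case True
        then have yx: "\<bar>y - x\<bar> \<le> r" by auto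
        have "L * \<bar>y - x\<bar> \<le> L * r" using yx L by (intro mult_left_mono) auto
        also have "L * r = e / 2" using L by (simp add: r_def)
        finally have "\<bar>f y - f x\<bar> \<le> e / 2" using lip[of y x] by linarith
        then have "e / 2 \<le> \<bar>f y\<bar>" using fx by linarith
        then have "(e / 2)\<^sup>2 \<le> (f y)\<^sup>2" using e abs_le_square_iff[of "e / 2" "f y"] by simp
        moreover have "real n \<le> \<bar>y\<bar>" using yx x by linarith
        ultimately show ?thesis using True by simp
      qed auto
    qed
    finally show False using n by simp
  qed
  then show ?thesis by blast
qed

section \<open>The pressure\<close>

text \<open>Comparison with a rescaled Cauchy profile: (1 + t^2) / 2 <= exp t with t = |y| / l
  bounds \<open>kernel l y\<close> by (1/l) / (1 + (y/l)^2).\<close>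

lemma integrable_kernel:
  assumes l: "l > 0"
  shows "integrable lborel (\<lambda>y. kernel l (x - y))"
proof -
  have q: "integrable lborel (\<lambda>\<xi>::real. inverse (1 + \<xi>\<^sup>2))"
    using integrable_inverse_1_plus_square by (simp add: set_integrable_def)
  have "integrable lborel (\<lambda>y. (1 / l) * inverse (1 + (0 + (1 / l) * y)\<^sup>2))"
    by (intro integrable_mult_right lborel_integrable_real_affine q) (use l in simp)
  then have k: "integrable lborel (kernel l)"
  proof (rule Bochner_Integration.integrable_bound)
    show "AE y in lborel. norm (kernel l y) \<le> norm ((1 / l) * inverse (1 + (0 + (1 / l) * y)\<^sup>2))"
    proof (intro always_eventually allI)
      fix y
      define t where "t = \<bar>y\<bar> / l"
      have t: "t \<ge> 0" using l by (simp add: t_def)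
      have "1 + t + t\<^sup>2 / 2 \<le> exp t" by (rule exp_lower_Taylor_quadratic[OF t])
      then have "(1 + t\<^sup>2) / 2 \<le> exp t" using t by (simp add: field_simps)
      moreover have "0 < (1 + t\<^sup>2) / 2" by (simp add: add_pos_nonneg)
      ultimately have "inverse (exp t) \<le> inverse ((1 + t\<^sup>2) / 2)" by (rule le_imp_inverse_le)
      then have "exp (- t) / (2 * l) \<le> (2 * inverse (1 + t\<^sup>2)) / (2 * l)"
        using l by (intro divide_right_mono) (auto simp: exp_minus inverse_eq_divide)
      moreover have "kernel l y = exp (- t) / (2 * l)" by (simp add: kernel_def t_def)
      moreover have "t\<^sup>2 = (0 + (1 / l) * y)\<^sup>2" by (simp add: t_def power_divide)
      ultimately show "norm (kernel l y) \<le> norm ((1 / l) * inverse (1 + (0 + (1 / l) * y)\<^sup>2))"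
        using l by (simp add: abs_mult add_nonneg_nonneg)
    qed
    show "kernel l \<in> borel_measurable lborel" unfolding kernel_def[abs_def] by measurable
  qed
  show ?thesis
    using lborel_integrable_real_affine[OF k, of "-1" x] by simp
qed

text \<open>The half-open interval fits the disjoint splittings of half-lines made for the pressure.
  It differs by a null set from the closed interval, to which the fundamental theorem of calculus
  applies.\<close>

lemma has_real_derivative_integral_greaterThanAtMost:
  fixes p :: "real \<Rightarrow> real"
  assumes p: "continuous_on UNIV p" and a: "a < x"
  shows "((\<lambda>u. LINT y:{a<..u}|lborel. p y) has_real_derivative p x) (at x)"
proof -
  have "((\<lambda>u. integral {a..u} p) has_real_derivative p x) (at x within {a..x + 1})"
    by (rule integral_has_real_derivative) (use a continuous_on_subset[OF p] in auto)
  then have "((\<lambda>u. integral {a..u} p) has_real_derivative p x) (at x)"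
    using at_within_interior[of x "{a..x + 1}"] a by simp
  then show ?thesis
  proof (rule has_field_derivative_transform_within[where d = "x - a"])
    show "0 < x - a" using a by simp
    fix u assume "dist u x < x - a"
    then have "a \<le> u" by (auto simp: dist_real_def)
    have "set_integrable lborel {a..u} p"
      unfolding set_integrable_def
      by (rule borel_integrable_compact) (auto intro: continuous_on_subset[OF p])
    then have "integral {a..u} p = (LINT y:{a..u}|lborel. p y)"
      by (rule set_borel_integral_eq_integral(2)[symmetric])
    also have "\<dots> = (LINT y:{a<..u}|lborel. p y)"
      unfolding set_lebesgue_integral_def
    proof (rule integral_cong_AE)
      have [measurable]: "p \<in> borel_measurable borel" by (rule borel_measurable_continuous_onI[OF p])
      show "(\<lambda>y. indicator {a..u} y *\<^sub>R p y) \<in> borel_measurable lborel"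
        "(\<lambda>y. indicator {a<..u} y *\<^sub>R p y) \<in> borel_measurable lborel" by measurable
      show "AE y in lborel. indicator {a..u} y *\<^sub>R p y = indicator {a<..u} y *\<^sub>R p y"
        using AE_lborel_singleton[of a] by eventually_elim (auto simp: indicator_def)
    qed
    finally show "integral {a..u} p = (LINT y:{a<..u}|lborel. p y)" .
  qed simp
qed

text \<open>The kernel is the Green function of 1 - l^2 d^2/dx^2. Splitting the convolution at y = x
  separates the exponentials and leaves the one-sided integrals \<open>A\<close> and
  \<open>B\<close> of continuous functions. The boundary terms \<open>w x\<close> cancel in the
  first derivative and add up in the second, which produces the term -w / l^2.\<close>

lemma pressure_derivatives:
  assumes l: "l > 0" and v: "continuous_on UNIV (deriv v)" and M: "\<And>x. \<bar>deriv v x\<bar> \<le> M"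
  shows "pressure l v x \<ge> 0"
    "(deriv (pressure l v) has_real_derivative (pressure l v x - (deriv v x)\<^sup>2 / 2) / l\<^sup>2) (at x)"
proof -
  show "pressure l v x \<ge> 0"
    unfolding pressure_def using l by (intro integral_nonneg_AE) (simp add: kernel_def)
  define w where "w y = (deriv v y)\<^sup>2 / 2" for y
  have wc: "continuous_on UNIV w" unfolding w_def by (intro continuous_intros v) simp
  then have [measurable]: "w \<in> borel_measurable borel" by (rule borel_measurable_continuous_onI)
  have wb: "\<bar>w y\<bar> \<le> M\<^sup>2 / 2" for y
  proof -
    have "(deriv v y)\<^sup>2 \<le> M\<^sup>2"
      using M[of y] abs_le_square_iff[of "deriv v y" M] by simp
    then show ?thesis by (simp add: w_def)
  qed
  have [measurable]: "kernel l \<in> borel_measurable borel" unfolding kernel_def[abs_def] by measurable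
  have k0: "kernel l z \<ge> 0" for z using l by (simp add: kernel_def)
  have kw: "integrable lborel (\<lambda>y. kernel l (x - y) * w y)" for x
  proof (rule Bochner_Integration.integrable_bound)
    show "integrable lborel (\<lambda>y. kernel l (x - y) * (M\<^sup>2 / 2))" using integrable_kernel[OF l] by simp
    show "AE y in lborel. norm (kernel l (x - y) * w y) \<le> norm (kernel l (x - y) * (M\<^sup>2 / 2))"
    proof (intro always_eventually allI)
      fix y
      have "kernel l (x - y) * \<bar>w y\<bar> \<le> kernel l (x - y) * (M\<^sup>2 / 2)" by (intro mult_left_mono wb k0)
      then show "norm (kernel l (x - y) * w y) \<le> norm (kernel l (x - y) * (M\<^sup>2 / 2))"
        using k0[of "x - y"] by (simp add: abs_mult)
    qed
  qed measurable
  \<comment> \<open>What remains of the integrand on the left (\<open>a\<close>) and on the right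
    (\<open>b\<close>) of x once the exponential in x is taken out.\<close>
  define a where "a y = exp (y / l) * w y" for y
  define b where "b y = exp (- (y / l)) * w y" for y
  have ac: "continuous_on UNIV a" "continuous_on UNIV b"
    unfolding a_def b_def using l by (auto intro!: continuous_intros wc)
  have aeq: "indicator {..x} y *\<^sub>R a y = (2 * l * exp (x / l)) * (indicator {..x} y *\<^sub>R (kernel l (x - y) * w y))" for x y
    using l by (auto simp: indicator_def kernel_def a_def exp_add[symmetric] field_simps simp flip: exp_add)
  have beq: "indicator {x<..} y *\<^sub>R b y = (2 * l * exp (- (x / l))) * (indicator {x<..} y *\<^sub>R (kernel l (x - y) * w y))" for x y
    using l by (auto simp: indicator_def kernel_def b_def field_simps simp flip: exp_add)
  have ikw: "integrable lborel (\<lambda>y. indicator S y *\<^sub>R (kernel l (x - y) * w y))" if "S \<in> sets borel" for S x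
    using integrable_mult_indicator[OF _ kw, of S x] that by simp
  have ai: "set_integrable lborel {..x} a" for x
    unfolding set_integrable_def aeq by (intro integrable_mult_right ikw) auto
  have bi: "set_integrable lborel {x<..} b" for x
    unfolding set_integrable_def beq by (intro integrable_mult_right ikw) auto
  define A where "A x = (LINT y:{..x}|lborel. a y)" for x
  define B where "B x = (LINT y:{x<..}|lborel. b y)" for x
  have P: "pressure l v x = (exp (- (x / l)) * A x + exp (x / l) * B x) / (2 * l)" for x
  proof -
    have "pressure l v x = (LINT y|lborel. indicator {..x} y *\<^sub>R (kernel l (x - y) * w y) + indicator {x<..} y *\<^sub>R (kernel l (x - y) * w y))"
      unfolding pressure_def w_def[symmetric]
      by (intro Bochner_Integration.integral_cong refl) (auto simp: indicator_def)
    also have "\<dots> = (LINT y|lborel. indicator {..x} y *\<^sub>R (kernel l (x - y) * w y)) + (LINT y|lborel. indicator {x<..} y *\<^sub>R (kernel l (x - y) * w y))"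
      by (intro Bochner_Integration.integral_add ikw) auto
    moreover have "A x = 2 * l * exp (x / l) * (LINT y|lborel. indicator {..x} y *\<^sub>R (kernel l (x - y) * w y))"
      unfolding A_def set_lebesgue_integral_def aeq by (rule integral_mult_right_zero)
    moreover have "B x = 2 * l * exp (- (x / l)) * (LINT y|lborel. indicator {x<..} y *\<^sub>R (kernel l (x - y) * w y))"
      unfolding B_def set_lebesgue_integral_def beq by (rule integral_mult_right_zero)
    ultimately show ?thesis using l by (simp add: exp_minus field_simps)
  qed
  have dA: "(A has_real_derivative a x) (at x)" for x
  proof -
    \<comment> \<open>A base point left of x turns the half-line integral into a constant plus an
      integral over a bounded interval; radius 1 around x keeps the end point to its right.\<close>
    let ?c = "x - 1"
    have "((\<lambda>u. A ?c + (LINT y:{?c<..u}|lborel. a y)) has_real_derivative a x) (at x)"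
      using DERIV_add[OF DERIV_const has_real_derivative_integral_greaterThanAtMost[OF ac(1)], of ?c x "A ?c"] by simp
    then show ?thesis
    proof (rule has_field_derivative_transform_within[where d = 1])
      fix u assume "dist u x < 1"
      then have "?c \<le> u" by (auto simp: dist_real_def)
      then have "{..u} = {..?c} \<union> {?c<..u}" by auto
      then show "A ?c + (LINT y:{?c<..u}|lborel. a y) = A u"
        unfolding A_def
        by (subst set_integral_Un[symmetric]) (auto intro: ai set_integrable_subset[OF ai[of u]])
    qed simp_all
  qed
  have dB: "(B has_real_derivative - b x) (at x)" for x
  proof -
    let ?c = "x - 1"
    have "((\<lambda>u. B ?c - (LINT y:{?c<..u}|lborel. b y)) has_real_derivative - b x) (at x)"
      using DERIV_diff[OF DERIV_const has_real_derivative_integral_greaterThanAtMost[OF ac(2)], of ?c x "B ?c"] by simp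
    then show ?thesis
    proof (rule has_field_derivative_transform_within[where d = 1])
      fix u assume "dist u x < 1"
      then have "?c \<le> u" by (auto simp: dist_real_def)
      then have un: "{?c<..} = {?c<..u} \<union> {u<..}" by auto
      have "B ?c = (LINT y:{?c<..u}|lborel. b y) + B u"
        unfolding B_def un
        by (rule set_integral_Un) (auto intro: bi set_integrable_subset[OF bi[of ?c]])
      then show "B ?c - (LINT y:{?c<..u}|lborel. b y) = B u" by simp
    qed simp_all
  qed
  define Q where "Q x = (exp (x / l) * B x - exp (- (x / l)) * A x) / (2 * l\<^sup>2)" for x
  have ab: "exp (- (x / l)) * a x = w x" "exp (x / l) * b x = w x" for x
    by (simp_all add: a_def b_def exp_minus)
  have dP: "(pressure l v has_real_derivative Q x) (at x)" for x
  proof -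
    have "((\<lambda>x. (exp (- (x / l)) * A x + exp (x / l) * B x) / (2 * l)) has_real_derivative
        ((exp (- (x / l)) * (- (1 / l)) * A x + exp (- (x / l)) * a x)
        + (exp (x / l) * (1 / l) * B x + exp (x / l) * (- b x))) / (2 * l)) (at x)"
      by (rule DERIV_cdivide) (use l in \<open>auto intro!: derivative_eq_intros dA dB\<close>)
    also have "((exp (- (x / l)) * (- (1 / l)) * A x + exp (- (x / l)) * a x)
        + (exp (x / l) * (1 / l) * B x + exp (x / l) * (- b x))) / (2 * l) = Q x"
      using l unfolding Q_def mult_minus_right ab by (simp add: field_simps power2_eq_square)
    finally show ?thesis unfolding P[abs_def] .
  qed
  have dQ: "(Q has_real_derivative (pressure l v x - w x) / l\<^sup>2) (at x)" for x
  proof -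
    have "(Q has_real_derivative
        ((exp (x / l) * (1 / l) * B x + exp (x / l) * (- b x))
        - (exp (- (x / l)) * (- (1 / l)) * A x + exp (- (x / l)) * a x)) / (2 * l\<^sup>2)) (at x)"
      unfolding Q_def[abs_def]
      by (rule DERIV_cdivide) (use l in \<open>auto intro!: derivative_eq_intros dA dB\<close>)
    also have "((exp (x / l) * (1 / l) * B x + exp (x / l) * (- b x))
        - (exp (- (x / l)) * (- (1 / l)) * A x + exp (- (x / l)) * a x)) / (2 * l\<^sup>2) = (pressure l v x - w x) / l\<^sup>2"
      using l unfolding P mult_minus_right ab by (simp add: field_simps power2_eq_square)
    finally show ?thesis .
  qed
  have "deriv (pressure l v) = Q" using DERIV_imp_deriv[OF dP] by auto
  then show "(deriv (pressure l v) has_real_derivative (pressure l v x - (deriv v x)\<^sup>2 / 2) / l\<^sup>2) (at x)"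
    using dQ[of x] by (simp add: w_def)
qed

section \<open>Steepest secant slopes\<close>

lemma compact_uniform_parameter:
  fixes R :: "real \<Rightarrow> 'a::metric_space \<Rightarrow> bool"
  assumes K: "compact K"
    and loc: "\<And>t. t \<in> K \<Longrightarrow> \<exists>d>0. \<exists>h>0. \<forall>\<tau>\<in>K. dist \<tau> t < d \<longrightarrow> R h \<tau>"
    and anti: "\<And>h h' \<tau>. 0 < h' \<Longrightarrow> h' \<le> h \<Longrightarrow> R h \<tau> \<Longrightarrow> R h' \<tau>"
  obtains h where "h > 0" "\<And>\<tau>. \<tau> \<in> K \<Longrightarrow> R h \<tau>"
proof -
  obtain d h where d: "\<And>t. t \<in> K \<Longrightarrow> d t > 0" and h: "\<And>t. t \<in> K \<Longrightarrow> h t > 0"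
    and R: "\<And>t \<tau>. t \<in> K \<Longrightarrow> \<tau> \<in> K \<Longrightarrow> dist \<tau> t < d t \<Longrightarrow> R (h t) \<tau>"
    using loc by metis
  have "K \<subseteq> (\<Union>t\<in>K. ball t (d t))" using d by force
  then obtain C where C: "C \<subseteq> K" "finite C" "K \<subseteq> (\<Union>t\<in>C. ball t (d t))"
    using compactE_image[OF K, of K "\<lambda>t. ball t (d t)"] by auto
  \<comment> \<open>The least of the finitely many local parameters serves every time, since smaller
    parameters inherit the property. The extra 1 keeps the set nonempty when \<open>K\<close> is
    empty.\<close>
  define m where "m = Min (insert 1 (h ` C))"
  have fin: "finite (insert 1 (h ` C))" using C by simp
  have m: "m > 0" unfolding m_def using fin C h by (subst Min_gr_iff) auto
  show ?thesis
  proof (rule that[OF m])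
    fix \<tau> assume \<tau>: "\<tau> \<in> K"
    then obtain t where t: "t \<in> C" "dist \<tau> t < d t" using C by (auto simp: dist_commute)
    have "R (h t) \<tau>" using R t C \<tau> by blast
    moreover have "m \<le> h t" unfolding m_def using fin t by (intro Min_le) auto
    ultimately show "R m \<tau>" using anti m by blast
  qed
qed

text \<open>The Sobolev norm dominates the sup norms of a function and of its derivative with
  constant 1; applied to u(tau) - u(t), this turns continuity into H^s into closeness uniform in
  x.\<close>

lemma sobolev_path_uniform_continuity:
  assumes s: "s \<ge> 2" and u: "continuous_into_sobolev s T u" and t: "t \<in> time_interval T" and e: "e > 0"
  shows "\<exists>d>0. \<forall>\<tau>\<in>time_interval T. dist \<tau> t < d \<longrightarrow>
    (\<forall>x. \<bar>u \<tau> x - u t x\<bar> < e \<and> \<bar>deriv (u \<tau>) x - deriv (u t) x\<bar> < e)"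
proof -
  have "((\<lambda>\<tau>. sobolev_norm s (\<lambda>x. u \<tau> x - u t x)) \<longlongrightarrow> 0) (at t within time_interval T)"
    using u t by (simp add: continuous_into_sobolev_def)
  then have "\<forall>\<^sub>F \<tau> in at t within time_interval T. sobolev_norm s (\<lambda>x. u \<tau> x - u t x) < e"
    by (rule order_tendstoD) (rule e)
  then obtain d where d: "d > 0"
    and N: "\<And>\<tau>. \<tau> \<in> time_interval T \<Longrightarrow> \<tau> \<noteq> t \<Longrightarrow> dist \<tau> t < d \<Longrightarrow> sobolev_norm s (\<lambda>x. u \<tau> x - u t x) < e"
    by (auto simp: eventually_at)
  have "\<bar>u \<tau> x - u t x\<bar> < e \<and> \<bar>deriv (u \<tau>) x - deriv (u t) x\<bar> < e"
    if \<tau>: "\<tau> \<in> time_interval T" "dist \<tau> t < d" for \<tau> x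
  proof (cases "\<tau> = t")
    case False
    have S: "u \<tau> \<in> sobolev s" "u t \<in> sobolev s"
      using u t \<tau> by (auto simp: continuous_into_sobolev_def)
    note D = sobolev_C1[OF s sobolev_diff[OF S]]
    have "((\<lambda>x. u \<tau> x - u t x) has_real_derivative deriv (u \<tau>) x - deriv (u t) x) (at x)"
      by (intro DERIV_diff sobolev_C1(1)[OF s] S)
    then have "deriv (\<lambda>x. u \<tau> x - u t x) x = deriv (u \<tau>) x - deriv (u t) x" by (rule DERIV_imp_deriv)
    then show ?thesis using D(2,3)[of x] N[OF \<tau>(1) False \<tau>(2)] by auto
  qed (use e in auto)
  then show ?thesis using d by blast
qed

lemma sobolev_path_derivative_bound:
  assumes s: "s \<ge> 2" and u: "continuous_into_sobolev s T u" and K: "compact K" "K \<subseteq> time_interval T"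
  obtains M where "M > 0" "\<And>t x. t \<in> K \<Longrightarrow> \<bar>deriv (u t) x\<bar> \<le> M"
proof -
  \<comment> \<open>The bound is written as 1/h so that it weakens as h shrinks, which is the
    monotonicity asked for by \<open>compact_uniform_parameter\<close>.\<close>
  have "\<exists>h>0. \<forall>t\<in>K. \<forall>x. \<bar>deriv (u t) x\<bar> \<le> 1 / h"
  proof (rule compact_uniform_parameter[OF K(1), of "\<lambda>h t. \<forall>x. \<bar>deriv (u t) x\<bar> \<le> 1 / h"])
    fix t assume t: "t \<in> K"
    obtain d where d: "d > 0" and D: "\<And>\<tau> x. \<tau> \<in> time_interval T \<Longrightarrow> dist \<tau> t < d \<Longrightarrow> \<bar>deriv (u \<tau>) x - deriv (u t) x\<bar> < 1"
      using sobolev_path_uniform_continuity[OF s u, of t 1] t K by force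
    have S: "u t \<in> sobolev s" using u t K by (auto simp: continuous_into_sobolev_def)
    let ?N = "sobolev_norm s (u t) + 1"
    have N: "?N > 0" by (simp add: sobolev_norm_def add_nonneg_pos)
    have "\<bar>deriv (u \<tau>) x\<bar> \<le> ?N" if "\<tau> \<in> K" "dist \<tau> t < d" for \<tau> x
      using D[of \<tau> x] that K sobolev_C1(3)[OF s S, of x] by fastforce
    then have "\<forall>\<tau>\<in>K. dist \<tau> t < d \<longrightarrow> (\<forall>x. \<bar>deriv (u \<tau>) x\<bar> \<le> 1 / (1 / ?N))" by simp
    then show "\<exists>d>0. \<exists>h>0. \<forall>\<tau>\<in>K. dist \<tau> t < d \<longrightarrow> (\<forall>x. \<bar>deriv (u \<tau>) x\<bar> \<le> 1 / h)"
      using d N by (metis zero_less_divide_1_iff)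
  next
    fix h h' :: real and \<tau> assume "0 < h'" "h' \<le> h" "\<forall>x. \<bar>deriv (u \<tau>) x\<bar> \<le> 1 / h"
    moreover have "1 / h \<le> 1 / h'" using \<open>0 < h'\<close> \<open>h' \<le> h\<close> by (intro divide_left_mono) auto
    ultimately show "\<forall>x. \<bar>deriv (u \<tau>) x\<bar> \<le> 1 / h'" by (meson order_trans)
  qed blast
  then obtain h where "h > 0" "\<And>t x. t \<in> K \<Longrightarrow> \<bar>deriv (u t) x\<bar> \<le> 1 / h" by blast
  then show ?thesis using that[of "1 / h"] by simp
qed

text \<open>At a single time the derivative is uniformly continuous in x. Nearby times follow from
  three errors of e/3 each, and compactness leaves one h for all times.\<close>

lemma sobolev_path_derivative_equicontinuous:
  assumes s: "s \<ge> 2" and u: "continuous_into_sobolev s T u" and K: "compact K" "K \<subseteq> time_interval T"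
    and e: "e > 0"
  obtains h where "h > 0" "\<And>t x y. t \<in> K \<Longrightarrow> \<bar>y - x\<bar> \<le> h \<Longrightarrow> \<bar>deriv (u t) y - deriv (u t) x\<bar> < e"
proof -
  have "\<exists>h>0. \<forall>t\<in>K. \<forall>x y. \<bar>y - x\<bar> \<le> h \<longrightarrow> \<bar>deriv (u t) y - deriv (u t) x\<bar> < e"
  proof (rule compact_uniform_parameter[OF K(1), of "\<lambda>h t. \<forall>x y. \<bar>y - x\<bar> \<le> h \<longrightarrow> \<bar>deriv (u t) y - deriv (u t) x\<bar> < e"])
    fix t assume t: "t \<in> K"
    obtain d where d: "d > 0" and D: "\<And>\<tau> x. \<tau> \<in> time_interval T \<Longrightarrow> dist \<tau> t < d \<Longrightarrow> \<bar>deriv (u \<tau>) x - deriv (u t) x\<bar> < e / 3"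
      using sobolev_path_uniform_continuity[OF s u, of t "e / 3"] t K e by force
    have S: "u t \<in> sobolev s" using u t K by (auto simp: continuous_into_sobolev_def)
    obtain h where h: "h > 0" and H: "\<And>x y. \<bar>y - x\<bar> < h \<Longrightarrow> \<bar>deriv (u t) y - deriv (u t) x\<bar> < e / 3"
      using sobolev_C1(4)[OF s S, of "e / 3"] e by auto
    \<comment> \<open>Halving \<open>h\<close> passes from the strict inequality in \<open>H\<close>
      to the non-strict one in the claim.\<close>
    have "\<bar>deriv (u \<tau>) y - deriv (u \<tau>) x\<bar> < e" if "\<tau> \<in> K" "dist \<tau> t < d" "\<bar>y - x\<bar> \<le> h / 2" for \<tau> x y
    proof -
      have \<tau>: "\<tau> \<in> time_interval T" using that K by auto
      show ?thesis
        using D[OF \<tau> that(2), of x] D[OF \<tau> that(2), of y] H[of y x] that(3) h by linarith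
    qed
    then show "\<exists>d>0. \<exists>h>0. \<forall>\<tau>\<in>K. dist \<tau> t < d \<longrightarrow> (\<forall>x y. \<bar>y - x\<bar> \<le> h \<longrightarrow> \<bar>deriv (u \<tau>) y - deriv (u \<tau>) x\<bar> < e)"
      using d h by (intro exI[of _ d] conjI exI[of _ "h / 2"]) auto
  next
    fix h h' :: real and \<tau> assume "h' \<le> h" "\<forall>x y. \<bar>y - x\<bar> \<le> h \<longrightarrow> \<bar>deriv (u \<tau>) y - deriv (u \<tau>) x\<bar> < e"
    then show "\<forall>x y. \<bar>y - x\<bar> \<le> h' \<longrightarrow> \<bar>deriv (u \<tau>) y - deriv (u \<tau>) x\<bar> < e" by (meson order_trans)
  qed blast
  then show ?thesis using that by blast
qed

section \<open>Motion of the steepest secant\<close>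

lemma difference_attains_minimum:
  assumes s: "s \<ge> 2" and f: "f \<in> sobolev s" and h: "h > 0" and neg: "f (x1 + h) - f x1 < 0"
  obtains z where "\<And>x. f (z + h) - f z \<le> f (x + h) - f x"
proof -
  let ?g = "\<lambda>x. f (x + h) - f x"
  \<comment> \<open>Where both values of \<open>f\<close> are below \<open>c\<close> in modulus, the
    difference exceeds -2 c, its value at \<open>x1\<close>. This holds outside [-B, B], as
    \<open>B\<close> includes h to keep x + h beyond \<open>R\<close> too; so the minimum over that
    interval, which contains \<open>x1\<close>, is global.\<close>
  define c where "c = - ?g x1 / 2"
  have c: "c > 0" using neg by (simp add: c_def)
  obtain R where R: "\<And>x. \<bar>x\<bar> > R \<Longrightarrow> \<bar>f x\<bar> < c" using sobolev_vanishes_at_infinity[OF s f c] by blast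
  define B where "B = \<bar>R\<bar> + h + \<bar>x1\<bar>"
  have fc: "continuous_on UNIV f" by (rule sobolev_fourier(1)[OF f])
  have "continuous_on {-B..B} ?g"
    by (intro continuous_intros continuous_on_compose2[OF fc]) auto
  moreover have "{-B..B} \<noteq> {}" using h by (auto simp: B_def)
  ultimately obtain z where z: "z \<in> {-B..B}" "\<And>x. x \<in> {-B..B} \<Longrightarrow> ?g z \<le> ?g x"
    using continuous_attains_inf[of "{-B..B}" ?g] by auto
  have x1: "x1 \<in> {-B..B}" using h by (auto simp: B_def)
  show ?thesis
  proof (rule that[of z])
    fix x
    show "?g z \<le> ?g x"
    proof (cases "x \<in> {-B..B}")
      case False
      then have "\<bar>x\<bar> > B" by auto
      then have "\<bar>x\<bar> > R" "\<bar>x + h\<bar> > R" using h by (auto simp: B_def)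
      from R[OF this(1)] R[OF this(2)] have "?g x \<ge> ?g x1" by (simp add: c_def abs_if split: if_splits)
      then show ?thesis using z(2)[OF x1] by linarith
    qed (rule z(2))
  qed
qed

text \<open>With p the common endpoint derivative, the transport terms combine into p times the
  increment of v, and the mean value theorem turns the increment of P_x into h times P_xx at a point
  zeta. Hence D = p n - P(zeta) + v'(zeta)^2 / 2, where p and v'(zeta) both lie within k n of
  -n.\<close>

lemma slope_derivative_at_minimum:
  assumes l: "l > 0" and s: "s \<ge> 2" and sol: "solution l s u0 T u" and t: "t \<in> time_interval T"
    and h: "h > 0" and k: "0 < k" "k < 1"
    and min: "\<And>x. (u t (z + h) - u t z) / h \<le> (u t (x + h) - u t x) / h"
    and neg: "(u t (z + h) - u t z) / h = - n" "n > 0"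
    and osc: "\<And>x y. \<bar>y - x\<bar> \<le> h \<Longrightarrow> \<bar>deriv (u t) y - deriv (u t) x\<bar> < k * n"
  obtains D where "((\<lambda>\<tau>. (u \<tau> (z + h) - u \<tau> z) / h) has_real_derivative D) (at t within time_interval T)"
    "D \<le> n\<^sup>2 * (3 * k - 1 / 2)"
proof -
  define v where "v = u t"
  define P where "P = pressure l v"
  have S: "v \<in> sobolev s" using sol t by (auto simp: solution_def continuous_into_sobolev_def v_def)
  note C1 = sobolev_C1[OF s S]
  have "continuous_on UNIV (deriv v)"
    unfolding continuous_on_iff dist_real_def
  proof (intro ballI allI impI)
    fix x e :: real assume "e > 0"
    then show "\<exists>d>0. \<forall>x'\<in>UNIV. \<bar>x' - x\<bar> < d \<longrightarrow> \<bar>deriv v x' - deriv v x\<bar> < e" using C1(4)[of e] by blast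
  qed
  note PD = pressure_derivatives[OF l this C1(3), folded P_def]
  have ut: "((\<lambda>\<tau>. u \<tau> x) has_real_derivative - (v x * deriv v x) - l\<^sup>2 * deriv P x) (at t within time_interval T)" for x
  proof -
    obtain c where c: "((\<lambda>\<tau>. u \<tau> x) has_real_derivative c) (at t within time_interval T)"
      "c + u t x * deriv (u t) x + l\<^sup>2 * deriv (pressure l (u t)) x = 0"
      using sol t unfolding solution_def by blast
    then have "c = - (v x * deriv v x) - l\<^sup>2 * deriv P x" by (simp add: v_def P_def)
    then show ?thesis using c(1) by simp
  qed
  define D where "D = ((- (v (z + h) * deriv v (z + h)) - l\<^sup>2 * deriv P (z + h)) - (- (v z * deriv v z) - l\<^sup>2 * deriv P z)) / h"
  have dD: "((\<lambda>\<tau>. (u \<tau> (z + h) - u \<tau> z) / h) has_real_derivative D) (at t within time_interval T)"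
    unfolding D_def by (intro DERIV_cdivide DERIV_diff ut)
  let ?p = "deriv v z"
  have crit: "deriv v (z + h) = ?p"
  proof -
    have "((\<lambda>x. v (x + h) - v x) has_real_derivative deriv v (z + h) * 1 - ?p) (at z)"
      by (intro DERIV_diff C1(1) DERIV_chain2[OF C1(1)]) (auto intro!: derivative_eq_intros)
    moreover have "\<forall>y. \<bar>z - y\<bar> < 1 \<longrightarrow> v (z + h) - v z \<le> v (y + h) - v y"
      using min h by (simp add: divide_le_cancel v_def)
    ultimately have "deriv v (z + h) * 1 - ?p = 0" using DERIV_local_min[OF _ zero_less_one] by blast
    then show ?thesis by simp
  qed
  have zh: "z < z + h" using h by simp
  \<comment> \<open>At this point the derivative equals the secant slope -n exactly;
    \<open>osc\<close> then compares the derivatives at \<open>z\<close> and at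
    \<open>\<zeta>\<close> with it.\<close>
  obtain \<theta> where th: "z < \<theta>" "\<theta> < z + h" "v (z + h) - v z = (z + h - z) * deriv v \<theta>"
    using MVT2[OF zh, of v "deriv v"] C1(1) by blast
  obtain \<zeta> where ze: "z < \<zeta>" "\<zeta> < z + h"
    "deriv P (z + h) - deriv P z = (z + h - z) * ((P \<zeta> - (deriv v \<zeta>)\<^sup>2 / 2) / l\<^sup>2)"
    using MVT2[OF zh, of "deriv P" "\<lambda>x. (P x - (deriv v x)\<^sup>2 / 2) / l\<^sup>2"] PD(2) by blast
  have slope: "v (z + h) - v z = - n * h" using neg(1) h by (simp add: v_def field_simps)
  then have "h * deriv v \<theta> = h * - n" using th(3) by simp
  then have mth: "deriv v \<theta> = - n" using h by (simp only: mult_cancel_left) simp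
  have p: "\<bar>?p + n\<bar> \<le> k * n" using osc[of \<theta> z] th mth by (simp add: v_def)
  have "\<bar>\<theta> - \<zeta>\<bar> \<le> h" using th ze by linarith
  from osc[OF this] have q: "\<bar>deriv v \<zeta> + n\<bar> \<le> k * n" using mth unfolding v_def by linarith
  have "D = ?p * n - (P \<zeta> - (deriv v \<zeta>)\<^sup>2 / 2)"
  proof -
    have "D = (- ?p * (v (z + h) - v z) - l\<^sup>2 * (deriv P (z + h) - deriv P z)) / h"
      unfolding D_def crit by (simp add: algebra_simps)
    also have "\<dots> = ?p * n - (P \<zeta> - (deriv v \<zeta>)\<^sup>2 / 2)"
      unfolding slope ze(3) using h l by (simp add: field_simps)
    finally show ?thesis .
  qed
  moreover have "?p * n \<le> (k * n - n) * n" using p neg(2) by (intro mult_right_mono) auto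
  moreover have "0 \<le> P \<zeta>" by (rule PD(1))
  moreover have "(deriv v \<zeta>)\<^sup>2 \<le> (n + k * n)\<^sup>2"
  proof -
    have "\<bar>deriv v \<zeta>\<bar> \<le> n + k * n" using q neg(2) by linarith
    then have "\<bar>deriv v \<zeta>\<bar>\<^sup>2 \<le> (n + k * n)\<^sup>2" by (intro power_mono) auto
    then show ?thesis by simp
  qed
  \<comment> \<open>For k = 0 the sum is -n^2 + n^2 / 2 = -n^2 / 2. The relative errors add up to 2
    k + k^2 / 2, at most 3 k because k < 1.\<close>
  moreover have "(k * n - n) * n + (n + k * n)\<^sup>2 / 2 = n\<^sup>2 * (2 * k - 1 / 2 + k * k / 2)"
    by (simp add: power2_eq_square field_simps)
  moreover have "n\<^sup>2 * (2 * k - 1 / 2 + k * k / 2) \<le> n\<^sup>2 * (3 * k - 1 / 2)"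
    using k mult_left_mono[of k 1 k] by (intro mult_left_mono) auto
  ultimately have "D \<le> n\<^sup>2 * (3 * k - 1 / 2)" by linarith
  then show ?thesis using that dD by blast
qed

text \<open>First exit argument: let sigma be the infimum of the times at which all slopes lie above
  the barrier. The barrier is still met at sigma, and a minimiser at sigma stays below it for a
  short while: by continuity if its slope is strictly below, by the strict differential inequality
  if it touches. This contradicts the choice of sigma.\<close>

lemma slope_comparison:
  assumes l: "l > 0" and s: "s \<ge> 2" and sol: "solution l s u0 T u" and t1: "0 < t1" "ereal t1 < T"
    and h: "h > 0" and a: "0 < a" "a < t1 / 2" and k: "0 < k" "k < 1" "3 * k < 1 / 2 - a / t1"
    and init: "\<exists>x. (u0 (x + h) - u0 x) / h \<le> - (1 / a)"
    and osc: "\<And>t x y. t \<in> {0..t1} \<Longrightarrow> \<bar>y - x\<bar> \<le> h \<Longrightarrow> \<bar>deriv (u t) y - deriv (u t) x\<bar> < k / a"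
    and t: "0 \<le> t" "t < t1"
  shows "\<exists>x. (u t (x + h) - u t x) / h \<le> - (1 / (a * (1 - t / t1)))"
proof -
  \<comment> \<open>Solves \<open>\<phi>' = - (a / t1) \<phi>\<^sup>2\<close>; since \<open>a / t1 < 1/2\<close> it is a strict supersolution of the Riccati equation.\<close>
  define \<phi> where "\<phi> t = - (1 / (a * (1 - t / t1)))" for t
  define g where "g t x = (u t (x + h) - u t x) / h" for t x
  have tv: "t \<in> time_interval T" if "0 \<le> t" "t < t1" for t
  proof -
    have "ereal t < ereal t1" using that by simp
    then show ?thesis using t1 that less_trans[of "ereal t" "ereal t1" T] by (simp add: time_interval_def)
  qed
  have cis: "continuous_into_sobolev s T u" using sol by (simp add: solution_def)
  have Su: "u t \<in> sobolev s" if "0 \<le> t" "t < t1" for t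
    using cis tv[OF that] by (auto simp: continuous_into_sobolev_def)
  have den: "0 < a * (1 - t / t1)" if "t < t1" for t using that t1 a by simp
  have dphi: "(\<phi> has_real_derivative - (a / t1) * (\<phi> t)\<^sup>2) (at t)" if "t < t1" for t
  proof -
    have "((\<lambda>t. a * (1 - t / t1)) has_real_derivative - (a / t1)) (at t)"
      using t1 by (auto intro!: derivative_eq_intros)
    moreover have "a * (1 - t / t1) \<noteq> 0" using den[OF that] by (metis less_irrefl)
    ultimately have "((\<lambda>t. - inverse (a * (1 - t / t1))) has_real_derivative
      - (- (inverse (a * (1 - t / t1)) * - (a / t1) * inverse (a * (1 - t / t1))))) (at t)"
      by (intro DERIV_minus DERIV_inverse')
    moreover have "\<phi> = (\<lambda>t. - inverse (a * (1 - t / t1)))" by (simp add: \<phi>_def inverse_eq_divide fun_eq_iff)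
    ultimately show ?thesis by (simp only: power2_eq_square) (simp add: mult_ac)
  qed
  have phineg: "\<phi> t \<le> - (1 / a)" if "0 \<le> t" "t < t1" for t
  proof -
    have "a * (1 - t / t1) \<le> a * 1" using that t1 a by (intro mult_left_mono) auto
    then have "1 / a \<le> 1 / (a * (1 - t / t1))"
      using den[OF that(2)] a by (intro divide_left_mono) auto
    then show ?thesis by (simp add: \<phi>_def)
  qed
  define S where "S = {t. 0 \<le> t \<and> t < t1 \<and> \<not> (\<exists>x. g t x \<le> \<phi> t)}"
  have "S = {}"
  proof (rule ccontr)
    assume ne: "S \<noteq> {}"
    have bb: "bdd_below S" by (auto simp: S_def intro!: bdd_belowI[of _ 0])
    define \<sigma> where "\<sigma> = Inf S"
    have lower: "\<sigma> \<le> t" if "t \<in> S" for t unfolding \<sigma>_def by (rule cInf_lower[OF that bb])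
    have \<sigma>0: "0 \<le> \<sigma>" unfolding \<sigma>_def by (rule cInf_greatest[OF ne]) (auto simp: S_def)
    have \<sigma>1: "\<sigma> < t1" using ne lower by (auto simp: S_def intro: le_less_trans)
    have below: "\<exists>x. g t x \<le> \<phi> t" if "0 \<le> t" "t < \<sigma>" for t
      using lower[of t] that \<sigma>1 by (auto simp: S_def)
    have minimiser: "\<exists>z. \<forall>x. g \<sigma> z \<le> g \<sigma> x" if "g \<sigma> x1 < 0" for x1
    proof -
      have "u \<sigma> (x1 + h) - u \<sigma> x1 < 0" using that h by (simp add: g_def divide_less_0_iff)
      then obtain z where "\<And>x. u \<sigma> (z + h) - u \<sigma> z \<le> u \<sigma> (x + h) - u \<sigma> x"
        using difference_attains_minimum[OF s Su[OF \<sigma>0 \<sigma>1] h] by blast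
      then have "\<forall>x. g \<sigma> z \<le> g \<sigma> x" using h by (simp add: g_def divide_right_mono)
      then show ?thesis ..
    qed
    \<comment> \<open>Were all slopes above the barrier at sigma, a uniform gap would persist at
      slightly earlier times, when the barrier is known to be met.\<close>
    have at: "\<exists>x. g \<sigma> x \<le> \<phi> \<sigma>"
    proof (cases "\<sigma> = 0")
      case True
      then show ?thesis using init sol by (simp add: g_def \<phi>_def solution_def)
    next
      case False
      show ?thesis
      proof (rule ccontr)
        assume no: "\<not> ?thesis"
        \<comment> \<open>The gap is uniform because a negative minimum is attained; if no slope is
          negative, the distance of the barrier from 0 serves.\<close>
        obtain \<delta> where \<delta>: "\<delta> > 0" "\<And>x. g \<sigma> x \<ge> \<phi> \<sigma> + \<delta>"
        proof (cases "\<exists>x. g \<sigma> x < 0")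
          case True
          then obtain z where "\<And>x. g \<sigma> z \<le> g \<sigma> x" using minimiser by blast
          moreover have "\<phi> \<sigma> < g \<sigma> z" using no by (auto simp: not_le)
          ultimately show ?thesis using that[of "g \<sigma> z - \<phi> \<sigma>"] by auto
        next
          case False
          have "0 < 1 / a" using a by simp
          then have "\<phi> \<sigma> < 0" using phineg[OF \<sigma>0 \<sigma>1] by linarith
          then show ?thesis using that[of "- \<phi> \<sigma>"] False by (auto simp: not_less)
        qed
        \<comment> \<open>Two endpoint errors of this size change a slope by less than a third of
          the gap; the barrier moves by less than another third, and a third remains.\<close>
        have "\<delta> * h / 6 > 0" using \<delta> h by simp
        from sobolev_path_uniform_continuity[OF s cis tv[OF \<sigma>0 \<sigma>1] this]
        obtain d where d: "d > 0" and U: "\<And>\<tau> x. \<tau> \<in> time_interval T \<Longrightarrow> dist \<tau> \<sigma> < d \<Longrightarrow> \<bar>u \<tau> x - u \<sigma> x\<bar> < \<delta> * h / 6"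
          by blast
        have "isCont \<phi> \<sigma>" using dphi[OF \<sigma>1] by (rule DERIV_isCont)
        then have "\<forall>\<^sub>F t in nhds \<sigma>. dist (\<phi> t) (\<phi> \<sigma>) < \<delta> / 3"
          using \<delta> by (intro tendstoD) (simp_all add: isCont_def tendsto_at_iff_tendsto_nhds)
        then obtain d' where d': "d' > 0" "\<And>t. dist t \<sigma> < d' \<Longrightarrow> dist (\<phi> t) (\<phi> \<sigma>) < \<delta> / 3"
          by (auto simp: eventually_nhds_metric)
        \<comment> \<open>The maximum with half of sigma keeps the earlier time nonnegative.\<close>
        define t where "t = max (\<sigma> / 2) (\<sigma> - min d d' / 2)"
        have ts: "0 \<le> t" "t < \<sigma>" "dist t \<sigma> < d" "dist t \<sigma> < d'"
          using d d'(1) \<sigma>0 False by (auto simp: t_def dist_real_def max_def min_def)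
        obtain x where x: "g t x \<le> \<phi> t" using below[OF ts(1,2)] by blast
        have tT: "t \<in> time_interval T" using tv ts \<sigma>1 by auto
        have "\<bar>(u t (x + h) - u t x) - (u \<sigma> (x + h) - u \<sigma> x)\<bar> < \<delta> * h / 3"
          using U[OF tT ts(3), of x] U[OF tT ts(3), of "x + h"] by linarith
        then have "\<bar>(u t (x + h) - u t x) - (u \<sigma> (x + h) - u \<sigma> x)\<bar> / h < \<delta> / 3"
          using h by (simp add: divide_less_eq)
        then have "\<bar>g t x - g \<sigma> x\<bar> < \<delta> / 3"
          unfolding g_def diff_divide_distrib[symmetric] using h by simp
        then show False using x \<delta>(2)[of x] \<delta>(1) d'(2)[OF ts(4)] unfolding dist_real_def by linarith
      qed
    qed
    then obtain x1 where x1: "g \<sigma> x1 \<le> \<phi> \<sigma>" by blast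
    have inva: "0 < 1 / a" using a by simp
    have phi0: "\<phi> \<sigma> < 0" using phineg[OF \<sigma>0 \<sigma>1] inva by linarith
    then obtain z where z: "\<And>x. g \<sigma> z \<le> g \<sigma> x" using minimiser[of x1] x1 by (meson le_less_trans)
    have gz: "g \<sigma> z \<le> \<phi> \<sigma>" using z x1 by (rule order_trans)
    define n where "n = - g \<sigma> z"
    have n: "1 / a \<le> n" using gz phineg[OF \<sigma>0 \<sigma>1] by (simp add: n_def)
    then have n0: "n > 0" using inva by linarith
    \<comment> \<open>The barrier never exceeds -1/a, so n >= 1/a, and the fixed oscillation bound
      k/a becomes one relative to n.\<close>
    have "k / a \<le> k * n" using mult_left_mono[OF n, of k] k by simp
    then have osc': "\<bar>deriv (u \<sigma>) y - deriv (u \<sigma>) x\<bar> < k * n" if "\<bar>y - x\<bar> \<le> h" for x y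
      using osc[of \<sigma>, OF _ that] \<sigma>0 \<sigma>1 by (auto intro: less_le_trans)
    obtain D where D: "((\<lambda>\<tau>. g \<tau> z) has_real_derivative D) (at \<sigma> within time_interval T)"
      and Dn: "D \<le> n\<^sup>2 * (3 * k - 1 / 2)"
      unfolding g_def
      by (rule slope_derivative_at_minimum[OF l s sol tv[OF \<sigma>0 \<sigma>1] h k(1,2), of z n])
        (use z n0 osc' in \<open>auto simp: g_def n_def\<close>)
    have dg: "((\<lambda>\<tau>. g \<tau> z - \<phi> \<tau>) has_real_derivative D - - (a / t1) * (\<phi> \<sigma>)\<^sup>2) (at \<sigma> within time_interval T)"
      by (intro DERIV_diff D has_field_derivative_at_within[OF dphi[OF \<sigma>1]])
    have "\<exists>d>0. \<forall>\<tau>\<in>time_interval T. \<sigma> < \<tau> \<longrightarrow> \<tau> < \<sigma> + d \<longrightarrow> g \<tau> z - \<phi> \<tau> < 0"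
    proof (cases "g \<sigma> z = \<phi> \<sigma>")
      case True
      \<comment> \<open>At contact the barrier value is -n, so both derivatives carry the factor n^2
        and the condition 3 k < 1/2 - a/t1 decides the sign.\<close>
      have "D + (a / t1) * (\<phi> \<sigma>)\<^sup>2 \<le> n\<^sup>2 * (3 * k - (1 / 2 - a / t1))"
        using Dn True by (simp add: n_def algebra_simps)
      also have "\<dots> < 0" using n0 k by (intro mult_pos_neg) auto
      finally have "D - - (a / t1) * (\<phi> \<sigma>)\<^sup>2 < 0" by simp
      from has_real_derivative_neg_dec_right[OF dg this]
      obtain d where d: "d > 0" "\<And>e. e > 0 \<Longrightarrow> \<sigma> + e \<in> time_interval T \<Longrightarrow> e < d \<Longrightarrow> g (\<sigma> + e) z - \<phi> (\<sigma> + e) < g \<sigma> z - \<phi> \<sigma>"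
        by blast
      have "g \<tau> z - \<phi> \<tau> < 0" if "\<tau> \<in> time_interval T" "\<sigma> < \<tau>" "\<tau> < \<sigma> + d" for \<tau>
        using d(2)[of "\<tau> - \<sigma>"] that True by simp
      then show ?thesis using d(1) by blast
    next
      case False
      then have "g \<sigma> z - \<phi> \<sigma> < 0" using gz by simp
      moreover have "((\<lambda>\<tau>. g \<tau> z - \<phi> \<tau>) \<longlongrightarrow> g \<sigma> z - \<phi> \<sigma>) (at \<sigma> within time_interval T)"
        using DERIV_continuous[OF dg] by (simp add: continuous_within)
      ultimately have "\<forall>\<^sub>F \<tau> in at \<sigma> within time_interval T. g \<tau> z - \<phi> \<tau> < 0"
        by (intro order_tendstoD)
      then show ?thesis by (fastforce simp: eventually_at dist_real_def)
    qed
    then obtain d where d: "d > 0" "\<And>\<tau>. \<tau> \<in> time_interval T \<Longrightarrow> \<sigma> < \<tau> \<Longrightarrow> \<tau> < \<sigma> + d \<Longrightarrow> g \<tau> z - \<phi> \<tau> < 0" by blast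
    \<comment> \<open>As the infimum of \<open>S\<close> but not a member of it, sigma has elements
      of \<open>S\<close> arbitrarily close on its right.\<close>
    obtain \<tau> where \<tau>: "\<tau> \<in> S" "\<tau> < \<sigma> + d"
      using cInf_lessD[OF ne, of "\<sigma> + d"] d(1) by (auto simp: \<sigma>_def)
    have "\<tau> \<noteq> \<sigma>" using \<tau>(1) x1 by (auto simp: S_def)
    then have "\<sigma> < \<tau>" using lower[OF \<tau>(1)] by simp
    moreover have "\<tau> \<in> time_interval T" using \<tau>(1) tv by (auto simp: S_def)
    ultimately have "g \<tau> z \<le> \<phi> \<tau>" using d(2)[of \<tau>] \<tau>(2) by simp
    then show False using \<tau>(1) by (auto simp: S_def)
  qed
  then show ?thesis using t by (auto simp: S_def g_def \<phi>_def)
qed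

text \<open>On the compact interval [0, \<open>t1\<close>] the derivative u_x is bounded, whereas an
  initial slope below -2/t1 would drive secant slopes, and with them values of u_x, to minus
  infinity as t approaches \<open>t1\<close>.\<close>

lemma solution_lifespan_bound:
  assumes l: "l > 0" and s: "s \<ge> 2" and sol: "solution l s u0 T u" and t1: "0 < t1" "ereal t1 < T"
  shows "- (2 / t1) \<le> deriv u0 x0"
proof (rule ccontr)
  assume "\<not> ?thesis"
  then have p0: "deriv u0 x0 < - (2 / t1)" by simp
  define p where "p = - deriv u0 x0"
  have "2 / t1 > 0" using t1 by simp
  then have p: "p > 2 / t1" "p > 0" using p0 unfolding p_def by linarith+
  have "1 / p < t1 / 2" using p t1 by (simp add: field_simps)
  \<comment> \<open>Because a > 1/p, the level -1/a lies above the derivative at \<open>x0\<close>,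
    so short secants from \<open>x0\<close> start below it; a < t1/2 leaves the margin 1/2 - a/t1
    for the errors.\<close>
  then obtain a where a: "1 / p < a" "a < t1 / 2" using dense by blast
  have a0: "a > 0" using a(1) p(2) by (meson less_trans zero_less_divide_1_iff)
  have ap: "1 / a < p" using a(1) a0 p(2) by (simp add: field_simps)
  \<comment> \<open>A quarter of the margin, so that 3 k stays strictly below it; in particular k <
    1/8.\<close>
  define k where "k = (1 / 2 - a / t1) / 4"
  have k: "0 < k" "k < 1" "3 * k < 1 / 2 - a / t1"
  proof -
    have "a / t1 < 1 / 2" "0 < a / t1" using a(2) a0 t1 by (auto simp: field_simps)
    then show "0 < k" "k < 1" "3 * k < 1 / 2 - a / t1" by (auto simp: k_def)
  qed
  have u: "continuous_into_sobolev s T u" and u00: "u 0 = u0" using sol by (auto simp: solution_def)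
  have K: "compact {0..t1}" "{0..t1} \<subseteq> time_interval T"
    using t1 le_less_trans[of _ "ereal t1" T] by (auto simp: time_interval_def)
  have S0: "u0 \<in> sobolev s" using u K t1 u00 by (fastforce simp: continuous_into_sobolev_def)
  obtain M where M: "M > 0" "\<And>t x. t \<in> {0..t1} \<Longrightarrow> \<bar>deriv (u t) x\<bar> \<le> M"
    using sobolev_path_derivative_bound[OF s u K] by blast
  have "k / a > 0" using k a0 by simp
  then obtain h1 where h1: "h1 > 0"
    "\<And>t x y. t \<in> {0..t1} \<Longrightarrow> \<bar>y - x\<bar> \<le> h1 \<Longrightarrow> \<bar>deriv (u t) y - deriv (u t) x\<bar> < k / a"
    using sobolev_path_derivative_equicontinuous[OF s u K] by blast
  have "((\<lambda>h. (u0 (x0 + h) - u0 x0) / h) \<longlongrightarrow> - p) (at 0)"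
    using sobolev_C1(1)[OF s S0, of x0] by (simp add: DERIV_def p_def)
  then have "\<forall>\<^sub>F h in at 0. (u0 (x0 + h) - u0 x0) / h < - (1 / a)"
    by (rule order_tendstoD) (use ap in simp)
  then obtain h2 where h2: "h2 > 0" "\<And>h. h \<noteq> 0 \<Longrightarrow> \<bar>h\<bar> < h2 \<Longrightarrow> (u0 (x0 + h) - u0 x0) / h < - (1 / a)"
    by (auto simp: eventually_at dist_real_def)
  define h where "h = min h1 (h2 / 2)"
  have h: "h > 0" "h \<le> h1" "h < h2" using h1(1) h2(1) by (auto simp: h_def)
  \<comment> \<open>At time t1 (1 - c) the barrier equals -1 / (a c), which is at most -2 M and so
    below every admissible slope. The cap 1/2 keeps this time nonnegative.\<close>
  define c where "c = min (1 / 2) (1 / (2 * a * M))"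
  have c: "0 < c" "c \<le> 1 / 2" "c \<le> 1 / (2 * a * M)" using a0 M(1) by (auto simp: c_def)
  define t where "t = t1 * (1 - c)"
  have t: "0 \<le> t" "t < t1" using c(1,2) t1 by (auto simp: t_def)
  have "\<exists>x. (u t (x + h) - u t x) / h \<le> - (1 / (a * (1 - t / t1)))"
  proof (rule slope_comparison[OF l s sol t1 h(1) a0 a(2) k _ _ t])
    show "\<exists>x. (u0 (x + h) - u0 x) / h \<le> - (1 / a)"
      using h2(2)[of h] h by (intro exI[of _ x0]) auto
    show "\<bar>deriv (u t) y - deriv (u t) x\<bar> < k / a" if "t \<in> {0..t1}" "\<bar>y - x\<bar> \<le> h" for t x y
      using h1(2)[OF that(1)] that(2) h(2) by simp
  qed
  then obtain x where x: "(u t (x + h) - u t x) / h \<le> - (1 / (a * (1 - t / t1)))" by blast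
  have "t \<in> time_interval T" using K(2) t by auto
  then have St: "u t \<in> sobolev s" using u by (simp add: continuous_into_sobolev_def)
  obtain \<theta> where th: "u t (x + h) - u t x = (x + h - x) * deriv (u t) \<theta>"
    using MVT2[of x "x + h" "u t" "deriv (u t)"] sobolev_C1(1)[OF s St] h(1) by auto
  have "(u t (x + h) - u t x) / h = deriv (u t) \<theta>" unfolding th using h(1) by simp
  then have "- M \<le> - (1 / (a * (1 - t / t1)))" using x M(2)[of t \<theta>] t by auto
  moreover have "1 - t / t1 = c" using t1 by (simp add: t_def)
  moreover have "2 * M \<le> 1 / (a * c)" using c(1,3) a0 M(1) by (simp add: field_simps)
  ultimately show False using M(1) by simp
qed

theorem proposition3p4:
  fixes l s :: real and u0 :: "real \<Rightarrow> real"
    and Tstar :: ereal and u :: "real \<Rightarrow> real \<Rightarrow> real"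
  assumes "l > 0"
    and "s \<ge> 2"
    and "u0 \<in> sobolev s"
    and "maximal_solution l s u0 Tstar u"
    and "\<exists>x0. deriv u0 x0 < 0"
  shows "Tstar \<le> ereal (- (2 / (INF x. deriv u0 x)))"
proof (rule ccontr)
  let ?I = "INF x. deriv u0 x"
  assume "\<not> ?thesis"
  then have "ereal (- (2 / ?I)) < Tstar" by simp
  \<comment> \<open>A real time is inserted strictly between the claimed bound and
    \<open>Tstar\<close>, which may be infinite.\<close>
  then obtain t1 where t1: "- (2 / ?I) < t1" "ereal t1 < Tstar"
    using ereal_dense2[of "ereal (- (2 / ?I))" Tstar] by auto
  \<comment> \<open>A real infimum has its usual properties only for a set bounded below; the
    Sobolev bound on the derivative ensures this.\<close>
  have bdd: "bdd_below (range (deriv u0))"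
    using sobolev_C1(3)[OF assms(2,3)] by (intro bdd_belowI2[of _ "- sobolev_norm s u0"]) (auto simp: abs_le_iff minus_le_iff)
  have "?I < 0" using assms(5) cINF_lower[OF bdd] by (meson UNIV_I le_less_trans)
  then have "t1 > 0" using t1(1) divide_pos_neg[of 2 ?I] by linarith
  have "?I < - (2 / t1)" using t1(1) \<open>?I < 0\<close> \<open>t1 > 0\<close> by (simp add: field_simps)
  then obtain x0 where "deriv u0 x0 < - (2 / t1)"
    using cINF_less_iff[OF _ bdd] by auto
  moreover have "solution l s u0 Tstar u" using assms(4) by (simp add: maximal_solution_def)
  then have "- (2 / t1) \<le> deriv u0 x0"
    using solution_lifespan_bound[OF assms(1,2) _ \<open>t1 > 0\<close> t1(2)] by blast
  ultimately show False by simp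
qed

end
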